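(* Let $S$ be a Hausdorff locally compact semitopological $0$-bisimple inverse $\omega$-semigroup with a compact maximal subgroup $G$ distinct from the zero subgroup (i.e. $G\neq\{0\}$). Then there is a continuous homomorphism $\theta\colon G\to G$ such that $S$ is topologically isomorphic either to $\left(\mathbf{B}(G,\theta)^0,\tau^{\oplus}_{\mathbf{B}}\right)$ or to $\left(\mathbf{B}(G,\theta)^0,\tau^{\mathsf{Ac}}_{\mathbf{B}}\right)$.
   Context: $\mathbb{N}_0$ is the set of non-negative integers. A semitopological semigroup is a semigroup with a topology for which multiplication is separately continuous. A topological isomorphism is a semigroup isomorphism that is a homeomorphism. An inverse semigroup $S$ with zero $0$ is a $0$-bisimple $\omega$-semigroup if it has exactly two $\mathscr{D}$-classes, $S\setminus\{0\}$ and $\{0\}$, and $E(S)\setminus\{0\}$ (the non-zero idempotents, with the natural order $e\leqslant f\iff ef=fe=e$) is order isomorphic to the $\omega$-chain $\{0,-1,-2,-3,\ldots\}$ with the usual order. For a group $G$ and a homomorphism $\theta\colon G\to G$, the Reilly semigroup $\mathbf{B}(G,\theta)$ is the set $\mathbb{N}_0\times G\times\mathbb{N}_0$ with $$(i,s,j)\cdot(m,t,n)=\left(i+m-\min\{j,m\},\ \theta^{m-\min\{j,m\}}(s)\,\theta^{j-\min\{j,m\}}(t),\ j+n-\min\{j,m\}\right),$$ where $\theta^0$ is the identity map and $\theta^k$ is the $k$-fold iterate. $\mathbf{B}(G,\theta)^0=\mathbf{B}(G,\theta)\sqcup\{\mathbf{0}\}$ is $\mathbf{B}(G,\theta)$ with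 an adjoined zero $\mathbf{0}$. For $A\subseteq G$ put $A_{i,j}=\{(i,s,j)\colon s\in A\}$. Here $G$ carries the subspace topology from $S$. The topologies on $\mathbf{B}(G,\theta)^0$ are: - $\tau^{\oplus}_{\mathbf{B}}$: a base at $(i,g,j)$ is $\{U_{i,j}\colon U \text{ in a base of } G \text{ at } g\}$, and $\mathbf{0}$ is isolated (i.e. the topological sum of the sets $G_{i,j}$, each a copy of $G$, and $\{\mathbf{0}\}$); - $\tau^{\mathsf{Ac}}_{\mathbf{B}}$ (for $G$ compact): a base at $(i,g,j)$ is as for $\tau^{\oplus}_{\mathbf{B}}$, and a base at $\mathbf{0}$ consists of all sets $\mathbf{B}(G,\theta)^0\setminus(G_{i_1,j_1}\cup\cdots\cup G_{i_k,j_k})$ with $(i_1,j_1),\ldots,(i_k,j_k)\in\mathbb{N}_0\times\mathbb{N}_0$ (i.e. the one-point compactification of $\bigoplus_{i,j}G_{i,j}$ with remainder $\{\mathbf{0}\}$). *)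

theory Defs
  imports "HOL-Algebra.Group" "HOL-Analysis.Analysis"
begin

section \<open>Semigroups on a carrier set\<close>

definition semigroup_on :: "'a set \<Rightarrow> ('a \<Rightarrow> 'a \<Rightarrow> 'a) \<Rightarrow> bool" where
  "semigroup_on S f \<longleftrightarrow>
     (\<forall>x\<in>S. \<forall>y\<in>S. f x y \<in> S) \<and>
     (\<forall>x\<in>S. \<forall>y\<in>S. \<forall>w\<in>S. f (f x y) w = f x (f y w))"

definition inverse_semigroup_on :: "'a set \<Rightarrow> ('a \<Rightarrow> 'a \<Rightarrow> 'a) \<Rightarrow> bool" where
  "inverse_semigroup_on S f \<longleftrightarrow>
     semigroup_on S f \<and> (\<forall>x\<in>S. \<exists>!y. y \<in> S \<and> f (f x y) x = x \<and> f (f y x) y = y)"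

definition zero_of_semigroup :: "'a set \<Rightarrow> ('a \<Rightarrow> 'a \<Rightarrow> 'a) \<Rightarrow> 'a \<Rightarrow> bool" where
  "zero_of_semigroup S f z \<longleftrightarrow> z \<in> S \<and> (\<forall>x\<in>S. f z x = z \<and> f x z = z)"

definition idempotents :: "'a set \<Rightarrow> ('a \<Rightarrow> 'a \<Rightarrow> 'a) \<Rightarrow> 'a set" where
  "idempotents S f = {e \<in> S. f e e = e}"

definition idem_le :: "('a \<Rightarrow> 'a \<Rightarrow> 'a) \<Rightarrow> 'a \<Rightarrow> 'a \<Rightarrow> bool" where
  "idem_le f e e' \<longleftrightarrow> f e e' = e \<and> f e' e = e"

text \<open>Green's relations.  The principal one-sided ideals are generated in \<open>S\<close> with an adjoined
  identity, hence the \<open>insert a\<close>.\<close>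

definition green_L :: "'a set \<Rightarrow> ('a \<Rightarrow> 'a \<Rightarrow> 'a) \<Rightarrow> 'a rel" where
  "green_L S f = {(a, b) \<in> S \<times> S. insert a ((\<lambda>x. f x a) ` S) = insert b ((\<lambda>x. f x b) ` S)}"

definition green_R :: "'a set \<Rightarrow> ('a \<Rightarrow> 'a \<Rightarrow> 'a) \<Rightarrow> 'a rel" where
  "green_R S f = {(a, b) \<in> S \<times> S. insert a ((\<lambda>x. f a x) ` S) = insert b ((\<lambda>x. f b x) ` S)}"

definition green_D :: "'a set \<Rightarrow> ('a \<Rightarrow> 'a \<Rightarrow> 'a) \<Rightarrow> 'a rel" where
  "green_D S f = green_L S f O green_R S f"

text \<open>As \<open>green_D\<close> is reflexive on \<open>S\<close>, the condition on the quotient forces \<open>S - {z}\<close> to be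
  nonempty, so that there are exactly two classes.\<close>

definition zero_bisimple_omega_semigroup :: "'a set \<Rightarrow> ('a \<Rightarrow> 'a \<Rightarrow> 'a) \<Rightarrow> 'a \<Rightarrow> bool" where
  "zero_bisimple_omega_semigroup S f z \<longleftrightarrow>
     inverse_semigroup_on S f \<and>
     zero_of_semigroup S f z \<and>
     S // green_D S f = {S - {z}, {z}} \<and>
     (\<exists>\<phi>. bij_betw \<phi> {..0::int} (idempotents S f - {z}) \<and>
          (\<forall>m\<in>{..0}. \<forall>n\<in>{..0}. m \<le> n \<longleftrightarrow> idem_le f (\<phi> m) (\<phi> n)))"

definition subgroup_of_semigroup ::
    "'a set \<Rightarrow> ('a \<Rightarrow> 'a \<Rightarrow> 'a) \<Rightarrow> 'a monoid \<Rightarrow> bool" where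
  "subgroup_of_semigroup S f G \<longleftrightarrow>
     group G \<and> carrier G \<subseteq> S \<and>
     (\<forall>x\<in>carrier G. \<forall>y\<in>carrier G. x \<otimes>\<^bsub>G\<^esub> y = f x y)"

definition maximal_subgroup_of_semigroup ::
    "'a set \<Rightarrow> ('a \<Rightarrow> 'a \<Rightarrow> 'a) \<Rightarrow> 'a monoid \<Rightarrow> bool" where
  "maximal_subgroup_of_semigroup S f G \<longleftrightarrow>
     subgroup_of_semigroup S f G \<and>
     (\<forall>H. subgroup_of_semigroup S f H \<and> carrier G \<subseteq> carrier H \<longrightarrow> carrier H = carrier G)"


section \<open>Topology on semigroups\<close>

definition semitopological_semigroup :: "'a topology \<Rightarrow> ('a \<Rightarrow> 'a \<Rightarrow> 'a) \<Rightarrow> bool" where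
  "semitopological_semigroup X f \<longleftrightarrow>
     semigroup_on (topspace X) f \<and>
     (\<forall>a\<in>topspace X. continuous_map X X (\<lambda>x. f a x) \<and> continuous_map X X (\<lambda>x. f x a))"

definition topologically_isomorphic ::
    "'a topology \<Rightarrow> ('a \<Rightarrow> 'a \<Rightarrow> 'a) \<Rightarrow> 'b topology \<Rightarrow> ('b \<Rightarrow> 'b \<Rightarrow> 'b) \<Rightarrow> bool" where
  "topologically_isomorphic X f Y g \<longleftrightarrow>
     (\<exists>h. homeomorphic_map X Y h \<and>
          (\<forall>x\<in>topspace X. \<forall>y\<in>topspace X. h (f x y) = g (h x) (h y)))"


section \<open>Reilly semigroups with adjoined zero\<close>

fun reilly_mult :: "'g monoid \<Rightarrow> ('g \<Rightarrow> 'g) \<Rightarrow> nat \<times> 'g \<times> nat \<Rightarrow> nat \<times> 'g \<times> nat \<Rightarrow> nat \<times> 'g \<times> nat" where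
  "reilly_mult G \<theta> (i, s, j) (m, t, n) =
     (i + m - min j m,
      (\<theta> ^^ (m - min j m)) s \<otimes>\<^bsub>G\<^esub> (\<theta> ^^ (j - min j m)) t,
      j + n - min j m)"

text \<open>The adjoined zero is \<open>None\<close>.\<close>

definition reilly0_carrier :: "'g set \<Rightarrow> (nat \<times> 'g \<times> nat) option set" where
  "reilly0_carrier A = insert None (Some ` (UNIV \<times> A \<times> UNIV))"

fun reilly0_mult :: "'g monoid \<Rightarrow> ('g \<Rightarrow> 'g) \<Rightarrow>
    (nat \<times> 'g \<times> nat) option \<Rightarrow> (nat \<times> 'g \<times> nat) option \<Rightarrow> (nat \<times> 'g \<times> nat) option" where
  "reilly0_mult G \<theta> (Some p) (Some q) = Some (reilly_mult G \<theta> p q)"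
| "reilly0_mult G \<theta> None q = None"
| "reilly0_mult G \<theta> p None = None"

text \<open>\<open>reilly_box i A j\<close> is the set $A_{i,j}$.\<close>

definition reilly_box :: "nat \<Rightarrow> 'g set \<Rightarrow> nat \<Rightarrow> (nat \<times> 'g \<times> nat) option set" where
  "reilly_box i A j = (\<lambda>s. Some (i, s, j)) ` A"

text \<open>Both topologies are given by neighbourhood bases, for a topology \<open>T\<close> on the group
  (so \<open>topspace T\<close> is the carrier of the group); neither depends on the endomorphism.\<close>

definition reilly_base_cond :: "'g topology \<Rightarrow> (nat \<times> 'g \<times> nat) option set \<Rightarrow> bool" where
  "reilly_base_cond T W \<longleftrightarrow>
     W \<subseteq> reilly0_carrier (topspace T) \<and>
     (\<forall>i g j. Some (i, g, j) \<in> W \<longrightarrow> (\<exists>U. openin T U \<and> g \<in> U \<and> reilly_box i U j \<subseteq> W))"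

definition reilly0_sum_topology :: "'g topology \<Rightarrow> (nat \<times> 'g \<times> nat) option topology" where
  "reilly0_sum_topology T = topology (reilly_base_cond T)"

definition reilly0_Ac_topology :: "'g topology \<Rightarrow> (nat \<times> 'g \<times> nat) option topology" where
  "reilly0_Ac_topology T = topology (\<lambda>W. reilly_base_cond T W \<and>
     (None \<in> W \<longrightarrow> (\<exists>F. finite F \<and>
        reilly0_carrier (topspace T) - (\<Union>(i, j)\<in>F. reilly_box i (topspace T) j) \<subseteq> W)))"

lemma reilly_base_cond_Int:
  assumes "reilly_base_cond T V" "reilly_base_cond T W"
  shows "reilly_base_cond T (V \<inter> W)"
  unfolding reilly_base_cond_def
proof (intro conjI allI impI)
  show "V \<inter> W \<subseteq> reilly0_carrier (topspace T)"
    using assms by (auto simp: reilly_base_cond_def)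
  fix i g j assume "Some (i, g, j) \<in> V \<inter> W"
  then obtain A B where "openin T A" "g \<in> A" "reilly_box i A j \<subseteq> V"
    "openin T B" "g \<in> B" "reilly_box i B j \<subseteq> W"
    using assms unfolding reilly_base_cond_def by (metis IntD1 IntD2)
  then show "\<exists>U. openin T U \<and> g \<in> U \<and> reilly_box i U j \<subseteq> V \<inter> W"
    by (intro exI[of _ "A \<inter> B"]) (auto simp: reilly_box_def)
qed

lemma reilly_base_cond_Union:
  assumes "\<And>W. W \<in> \<W> \<Longrightarrow> reilly_base_cond T W"
  shows "reilly_base_cond T (\<Union>\<W>)"
  using assms unfolding reilly_base_cond_def by (meson Sup_le_iff UnionE Union_upper order_trans)

lemma openin_reilly0_sum_topology:
  "openin (reilly0_sum_topology T) W \<longleftrightarrow> reilly_base_cond T W"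
proof -
  have "istopology (reilly_base_cond T)"
    by (simp add: istopology_def reilly_base_cond_Int reilly_base_cond_Union)
  then show ?thesis by (simp add: reilly0_sum_topology_def)
qed

lemma openin_reilly0_Ac_topology:
  "openin (reilly0_Ac_topology T) W \<longleftrightarrow> reilly_base_cond T W \<and>
     (None \<in> W \<longrightarrow> (\<exists>F. finite F \<and>
        reilly0_carrier (topspace T) - (\<Union>(i, j)\<in>F. reilly_box i (topspace T) j) \<subseteq> W))"
proof -
  let ?C = "\<lambda>F. reilly0_carrier (topspace T) - (\<Union>(i, j)\<in>F. reilly_box i (topspace T) j)"
  let ?P = "\<lambda>W. reilly_base_cond T W \<and> (None \<in> W \<longrightarrow> (\<exists>F. finite F \<and> ?C F \<subseteq> W))"
  have "istopology ?P"
    unfolding istopology_def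
  proof (rule conjI; intro allI impI)
    fix V W assume V: "?P V" and W: "?P W"
    have "\<exists>F. finite F \<and> ?C F \<subseteq> V \<inter> W" if "None \<in> V \<inter> W"
    proof -
      from that V have "\<exists>F. finite F \<and> ?C F \<subseteq> V" by blast
      moreover from that W have "\<exists>F. finite F \<and> ?C F \<subseteq> W" by blast
      ultimately obtain F F' where "finite F" "?C F \<subseteq> V" "finite F'" "?C F' \<subseteq> W"
        by blast
      then show ?thesis by (intro exI[of _ "F \<union> F'"]) blast
    qed
    then show "?P (V \<inter> W)" using V W by (simp add: reilly_base_cond_Int)
  next
    fix \<W> assume "\<forall>W\<in>\<W>. ?P W"
    then show "?P (\<Union>\<W>)"
      by (meson UnionE Union_upper order_trans reilly_base_cond_Union)
  qed
  then show ?thesis by (simp add: reilly0_Ac_topology_def)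
qed

lemma reilly_base_cond_carrier: "reilly_base_cond T (reilly0_carrier (topspace T))"
  unfolding reilly_base_cond_def reilly0_carrier_def reilly_box_def
  by (auto intro!: exI[of _ "topspace T"])

lemma topspace_reilly0_sum_topology:
  "topspace (reilly0_sum_topology T) = reilly0_carrier (topspace T)"
proof (rule antisym)
  show "topspace (reilly0_sum_topology T) \<subseteq> reilly0_carrier (topspace T)"
    using openin_topspace[of "reilly0_sum_topology T"]
    unfolding openin_reilly0_sum_topology reilly_base_cond_def by blast
  have "openin (reilly0_sum_topology T) (reilly0_carrier (topspace T))"
    using reilly_base_cond_carrier by (auto simp: openin_reilly0_sum_topology)
  then show "reilly0_carrier (topspace T) \<subseteq> topspace (reilly0_sum_topology T)"
    by (rule openin_subset)
qed

lemma topspace_reilly0_Ac_topology: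
  "topspace (reilly0_Ac_topology T) = reilly0_carrier (topspace T)"
proof (rule antisym)
  show "topspace (reilly0_Ac_topology T) \<subseteq> reilly0_carrier (topspace T)"
    using openin_topspace[of "reilly0_Ac_topology T"]
    unfolding openin_reilly0_Ac_topology reilly_base_cond_def by blast
  have "openin (reilly0_Ac_topology T) (reilly0_carrier (topspace T))"
    using reilly_base_cond_carrier by (auto simp: openin_reilly0_Ac_topology)
  then show "reilly0_carrier (topspace T) \<subseteq> topspace (reilly0_Ac_topology T)"
    by (rule openin_subset)
qed

text \<open>The sets prescribed as neighbourhood bases are open.\<close>

lemma reilly_base_cond_box: "openin T U \<Longrightarrow> reilly_base_cond T (reilly_box i U j)"
  using openin_subset[of T U]
  by (auto simp: reilly_base_cond_def reilly_box_def reilly0_carrier_def)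

lemma openin_reilly0_box:
  assumes "openin T U"
  shows "openin (reilly0_sum_topology T) (reilly_box i U j)"
    and "openin (reilly0_Ac_topology T) (reilly_box i U j)"
  using reilly_base_cond_box[OF assms]
  by (auto simp: openin_reilly0_sum_topology openin_reilly0_Ac_topology reilly_box_def)

lemma openin_reilly0_sum_zero: "openin (reilly0_sum_topology T) {None}"
  by (simp add: openin_reilly0_sum_topology reilly_base_cond_def reilly0_carrier_def)

lemma openin_reilly0_Ac_zero:
  assumes "finite F"
  shows "openin (reilly0_Ac_topology T)
    (reilly0_carrier (topspace T) - (\<Union>(i, j)\<in>F. reilly_box i (topspace T) j))"
    (is "openin _ ?W")
proof -
  have "\<exists>U. openin T U \<and> g \<in> U \<and> reilly_box i U j \<subseteq> ?W" if "Some (i, g, j) \<in> ?W" for i g j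
    using that
    by (intro exI[of _ "topspace T"]) (auto simp: reilly0_carrier_def reilly_box_def)
  then show ?thesis
    using assms by (auto simp: openin_reilly0_Ac_topology reilly_base_cond_def)
qed

end

theory Submission imports Defs begin

text \<open>Write \<open>E 0 > E 1 > \<dots>\<close> for the nonzero idempotents. They are \<open>\<D>\<close>-related, so some \<open>a\<close> satisfies
  \<open>a a\<^sup>\<star> = E 0\<close> and \<open>a\<^sup>\<star> a = E 1\<close>; put \<open>b = a\<^sup>\<star>\<close>. The chain of the natural numbers has no
  order embedding onto a final segment except the translation, and therefore conjugation by \<open>a\<close> and
  \<open>b\<close> shifts the idempotents while conjugation by a unit fixes them (\<open>conjugate_E\<close>). Consequently
  \<open>b\<^sup>i a\<^sup>i = E i\<close>, and every nonzero element is uniquely \<open>b\<^sup>i s a\<^sup>j\<close> with \<open>s\<close> a unit. Units move past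
  \<open>a\<close> and \<open>b\<close> through the endomorphism \<open>s \<mapsto> a s b\<close>, which gives Reilly's multiplication
  (\<open>coord_mult\<close>). A maximal subgroup \<open>G\<close> is the \<open>\<H>\<close>-class of some \<open>E k\<close>; it is carried to the group of
  units by \<open>s \<mapsto> a\<^sup>k s b\<^sup>k\<close>, and the endomorphism is transported along this isomorphism. All these maps
  are products of translations, hence continuous.

  The class \<open>Hclass i j\<close> of the elements \<open>b\<^sup>i s a\<^sup>j\<close> is a copy of \<open>G\<close>: compact, and hence closed. It is
  also open, because the elements fixed neither by \<open>E (i + 1)\<close> on the left nor by \<open>E (j + 1)\<close> on the
  right form an open set that is a finite union of such classes, and the others in that union are
  closed (\<open>openin_Hclass\<close>). So away from the
  zero the topology is the topological sum, and only the neighbourhoods of the zero are in question.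

  If the zero is not isolated, let \<open>V\<close> be an open neighbourhood of it inside a compact set \<open>K\<close>. A
  continuous map fixing the zero maps \<open>V \<inter> Hclass i j\<close> into \<open>V\<close> for almost all \<open>(i, j)\<close>: the points
  of \<open>K\<close> that it maps outside \<open>V\<close> form a compact set avoiding the zero, which the disjoint open
  classes cover. Applied to the translations by \<open>a\<close> and \<open>b\<close> this shows that the set \<open>A\<close> of group
  coordinates of \<open>V \<inter> Hclass i j\<close> is the same for almost all \<open>(i, j)\<close>. It is nonempty, as the zero is
  not isolated. Applied to the left translation by \<open>g \<in> G\<close>, which acts on the classes \<open>Hclass 0 j\<close>
  by \<open>s \<mapsto> g s\<close>, it shows \<open>g A \<subseteq> A\<close>. Hence \<open>A = G\<close>, so \<open>V\<close> contains almost all classes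
  (\<open>almost_all_Hclasses_in_compact_neighbourhood\<close>), and the topology is the one-point
  compactification.\<close>

section \<open>Inverse semigroups\<close>

locale inverse_semigroup =
  fixes S :: "'a set" and f :: "'a \<Rightarrow> 'a \<Rightarrow> 'a" (infixl "\<cdot>" 70)
  assumes inverse_semigroup_on: "inverse_semigroup_on S (\<cdot>)"
begin

lemma closed [simp]: "x \<in> S \<Longrightarrow> y \<in> S \<Longrightarrow> x \<cdot> y \<in> S"
  using inverse_semigroup_on by (simp add: inverse_semigroup_on_def semigroup_on_def)

lemma assoc: "x \<in> S \<Longrightarrow> y \<in> S \<Longrightarrow> w \<in> S \<Longrightarrow> x \<cdot> y \<cdot> w = x \<cdot> (y \<cdot> w)"
  using inverse_semigroup_on by (simp add: inverse_semigroup_on_def semigroup_on_def)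

definition sinv :: "'a \<Rightarrow> 'a" (\<open>_\<^sup>\<star>\<close> [1000] 1000) where
  "x\<^sup>\<star> = (THE y. y \<in> S \<and> x \<cdot> y \<cdot> x = x \<and> y \<cdot> x \<cdot> y = y)"

lemma ex1_inverse: "x \<in> S \<Longrightarrow> \<exists>!y. y \<in> S \<and> x \<cdot> y \<cdot> x = x \<and> y \<cdot> x \<cdot> y = y"
  using inverse_semigroup_on by (simp add: inverse_semigroup_on_def)

lemma sinv:
  assumes "x \<in> S"
  shows sinv_closed [simp]: "x\<^sup>\<star> \<in> S" and "x \<cdot> x\<^sup>\<star> \<cdot> x = x" and "x\<^sup>\<star> \<cdot> x \<cdot> x\<^sup>\<star> = x\<^sup>\<star>"
  using theI'[OF ex1_inverse[OF assms]] by (auto simp: sinv_def)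

lemma sinv_cancel [simp]:
  assumes "x \<in> S"
  shows "x \<cdot> (x\<^sup>\<star> \<cdot> x) = x" and "x\<^sup>\<star> \<cdot> (x \<cdot> x\<^sup>\<star>) = x\<^sup>\<star>"
  using sinv(2,3)[OF assms] assms by (simp_all add: assoc)

lemma sinv_cancel_left [simp]:
  assumes "x \<in> S" "w \<in> S"
  shows "x \<cdot> (x\<^sup>\<star> \<cdot> (x \<cdot> w)) = x \<cdot> w" and "x\<^sup>\<star> \<cdot> (x \<cdot> (x\<^sup>\<star> \<cdot> w)) = x\<^sup>\<star> \<cdot> w"
proof -
  have "x \<cdot> (x\<^sup>\<star> \<cdot> x) \<cdot> w = x \<cdot> (x\<^sup>\<star> \<cdot> (x \<cdot> w))" "x\<^sup>\<star> \<cdot> (x \<cdot> x\<^sup>\<star>) \<cdot> w = x\<^sup>\<star> \<cdot> (x \<cdot> (x\<^sup>\<star> \<cdot> w))"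
    using assms by (simp_all only: assoc closed sinv_closed)
  then show "x \<cdot> (x\<^sup>\<star> \<cdot> (x \<cdot> w)) = x \<cdot> w" "x\<^sup>\<star> \<cdot> (x \<cdot> (x\<^sup>\<star> \<cdot> w)) = x\<^sup>\<star> \<cdot> w"
    using assms by simp_all
qed

lemma sinv_eqI: "x \<in> S \<Longrightarrow> y \<in> S \<Longrightarrow> x \<cdot> y \<cdot> x = x \<Longrightarrow> y \<cdot> x \<cdot> y = y \<Longrightarrow> x\<^sup>\<star> = y"
  using ex1_inverse[of x] sinv[of x] by metis

lemma sinv_sinv [simp]: "x \<in> S \<Longrightarrow> x\<^sup>\<star>\<^sup>\<star> = x"
  by (rule sinv_eqI) (simp_all add: assoc)

abbreviation idem :: "'a \<Rightarrow> bool" where "idem e \<equiv> e \<in> S \<and> e \<cdot> e = e"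

lemma idem_left: "idem e \<Longrightarrow> x \<in> S \<Longrightarrow> e \<cdot> (e \<cdot> x) = e \<cdot> x"
  by (simp flip: assoc)

lemma sinv_idem: "idem e \<Longrightarrow> e\<^sup>\<star> = e"
  by (rule sinv_eqI) auto

lemma idem_mult_sinv: "x \<in> S \<Longrightarrow> idem (x \<cdot> x\<^sup>\<star>)" and idem_sinv_mult: "x \<in> S \<Longrightarrow> idem (x\<^sup>\<star> \<cdot> x)"
  by (simp_all add: assoc)

text \<open>With \<open>x\<close> the inverse of \<open>e \<cdot> g\<close>, the element \<open>g \<cdot> x \<cdot> e\<close> is again an inverse of \<open>e \<cdot> g\<close>, so it
  equals \<open>x\<close>; and it is idempotent. As \<open>e \<cdot> g\<close> is the inverse of the idempotent \<open>x\<close>, it is \<open>x\<close>.\<close>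

lemma idem_mult:
  assumes e: "idem e" and g: "idem g"
  shows "idem (e \<cdot> g)"
proof -
  define x where "x = (e \<cdot> g)\<^sup>\<star>"
  have x: "x \<in> S" using e g by (simp add: x_def)
  have c1: "e \<cdot> (g \<cdot> (x \<cdot> (e \<cdot> g))) = e \<cdot> g"
    using sinv(2)[of "e \<cdot> g"] e g x by (simp add: x_def[symmetric] assoc)
  have c2: "x \<cdot> (e \<cdot> (g \<cdot> x)) = x"
    using sinv(3)[of "e \<cdot> g"] e g x by (simp add: x_def[symmetric] assoc)
  have c3: "x \<cdot> (e \<cdot> (g \<cdot> (x \<cdot> e))) = x \<cdot> e"
    using c2 e g x by (metis assoc closed)
  have "x = g \<cdot> x \<cdot> e"
    unfolding x_def
    by (rule sinv_eqI) (use e g x c1 c3 in \<open>simp_all add: assoc idem_left flip: x_def\<close>)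
  moreover have "g \<cdot> x \<cdot> e \<cdot> (g \<cdot> x \<cdot> e) = g \<cdot> x \<cdot> e"
    using c3 e g x by (simp add: assoc)
  ultimately have xx: "idem x" using x by metis
  have "x\<^sup>\<star> = e \<cdot> g" using e g by (simp add: x_def)
  with xx show ?thesis using sinv_idem by metis
qed

text \<open>Both \<open>e \<cdot> g\<close> and \<open>g \<cdot> e\<close> are inverses of the idempotent \<open>e \<cdot> g\<close>; inverses are unique.\<close>

lemma idem_commute:
  assumes e: "idem e" and g: "idem g"
  shows "e \<cdot> g = g \<cdot> e"
proof -
  have eg: "idem (e \<cdot> g)" and ge: "idem (g \<cdot> e)" using idem_mult e g by auto
  then have "e \<cdot> (g \<cdot> (e \<cdot> g)) = e \<cdot> g" "g \<cdot> (e \<cdot> (g \<cdot> e)) = g \<cdot> e"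
    using e g by (simp_all add: assoc)
  then have "(e \<cdot> g)\<^sup>\<star> = g \<cdot> e"
    by (intro sinv_eqI) (use e g in \<open>simp_all add: assoc idem_left\<close>)
  then show ?thesis using sinv_idem[OF eg] by simp
qed

lemma sinv_mult:
  assumes "x \<in> S" "y \<in> S"
  shows "(x \<cdot> y)\<^sup>\<star> = y\<^sup>\<star> \<cdot> x\<^sup>\<star>"
proof (rule sinv_eqI)
  have comm: "y \<cdot> (y\<^sup>\<star> \<cdot> (x\<^sup>\<star> \<cdot> (x \<cdot> w))) = x\<^sup>\<star> \<cdot> (x \<cdot> (y \<cdot> (y\<^sup>\<star> \<cdot> w)))" if "w \<in> S" for w
  proof -
    have "(y \<cdot> y\<^sup>\<star>) \<cdot> (x\<^sup>\<star> \<cdot> x) \<cdot> w = (x\<^sup>\<star> \<cdot> x) \<cdot> (y \<cdot> y\<^sup>\<star>) \<cdot> w"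
      using idem_commute[OF idem_mult_sinv idem_sinv_mult] assms by metis
    then show ?thesis using assms that by (simp only: assoc closed sinv_closed)
  qed
  show "x \<cdot> y \<cdot> (y\<^sup>\<star> \<cdot> x\<^sup>\<star>) \<cdot> (x \<cdot> y) = x \<cdot> y"
    using assms by (simp add: assoc comm)
  show "y\<^sup>\<star> \<cdot> x\<^sup>\<star> \<cdot> (x \<cdot> y) \<cdot> (y\<^sup>\<star> \<cdot> x\<^sup>\<star>) = y\<^sup>\<star> \<cdot> x\<^sup>\<star>"
    using assms by (simp add: assoc comm[symmetric])
qed (use assms in auto)

text \<open>In an inverse semigroup each one-sided principal ideal has a unique idempotent generator, namely
  \<open>c\<^sup>\<star> \<cdot> c\<close> or \<open>c \<cdot> c\<^sup>\<star>\<close>.\<close>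

lemma green_L_idem:
  assumes "(c, e) \<in> green_L S (\<cdot>)" "idem e"
  shows "c \<in> S" "c\<^sup>\<star> \<cdot> c = e"
proof -
  have c: "c \<in> S" and eq: "insert c ((\<lambda>x. x \<cdot> c) ` S) = insert e ((\<lambda>x. x \<cdot> e) ` S)"
    using assms by (auto simp: green_L_def)
  from eq have "c \<in> insert e ((\<lambda>x. x \<cdot> e) ` S)" by blast
  then have ce: "c \<cdot> e = c" using assms(2) by (auto simp: assoc)
  from eq have "e \<in> insert c ((\<lambda>x. x \<cdot> c) ` S)" by blast
  then have e: "e \<cdot> (c\<^sup>\<star> \<cdot> c) = e" using c by (auto simp: assoc)
  have "c\<^sup>\<star> \<cdot> c = c\<^sup>\<star> \<cdot> c \<cdot> e" using c assms(2) ce by (simp add: assoc)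
  also have "\<dots> = e \<cdot> (c\<^sup>\<star> \<cdot> c)" using idem_commute[OF idem_sinv_mult[OF c] assms(2)] .
  finally show "c\<^sup>\<star> \<cdot> c = e" using e by simp
  show "c \<in> S" by fact
qed

lemma green_R_idem:
  assumes "(c, e) \<in> green_R S (\<cdot>)" "idem e"
  shows "c \<cdot> c\<^sup>\<star> = e"
proof -
  have c: "c \<in> S" and eq: "insert c ((\<lambda>x. c \<cdot> x) ` S) = insert e ((\<lambda>x. e \<cdot> x) ` S)"
    using assms by (auto simp: green_R_def)
  from eq have "c \<in> insert e ((\<lambda>x. e \<cdot> x) ` S)" by blast
  then have ce: "e \<cdot> c = c" using assms(2) by (auto simp: idem_left)
  from eq have "e \<in> insert c ((\<lambda>x. c \<cdot> x) ` S)" by blast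
  then have e: "(c \<cdot> c\<^sup>\<star>) \<cdot> e = e" using c by (auto simp: assoc)
  have "c \<cdot> c\<^sup>\<star> = e \<cdot> (c \<cdot> c\<^sup>\<star>)" using c assms(2) ce by (simp flip: assoc)
  also have "\<dots> = (c \<cdot> c\<^sup>\<star>) \<cdot> e" using idem_commute[OF assms(2) idem_mult_sinv[OF c]] .
  finally show "c \<cdot> c\<^sup>\<star> = e" using e by simp
qed

text \<open>The inverse of a group element inside \<open>G\<close> is also its semigroup inverse, so \<open>G\<close> lies in the
  \<open>\<H>\<close>-class of its identity; that class is itself a group, and maximality gives equality.\<close>

lemma maximal_subgroup_carrier:
  assumes "maximal_subgroup_of_semigroup S (\<cdot>) G"
  shows "idem \<one>\<^bsub>G\<^esub>" "carrier G = {x \<in> S. x \<cdot> x\<^sup>\<star> = \<one>\<^bsub>G\<^esub> \<and> x\<^sup>\<star> \<cdot> x = \<one>\<^bsub>G\<^esub>}"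
proof -
  interpret group G
    using assms by (simp add: maximal_subgroup_of_semigroup_def subgroup_of_semigroup_def)
  have sub: "carrier G \<subseteq> S" and op: "\<And>x y. x \<in> carrier G \<Longrightarrow> y \<in> carrier G \<Longrightarrow> x \<otimes>\<^bsub>G\<^esub> y = x \<cdot> y"
    and max: "\<And>H. subgroup_of_semigroup S (\<cdot>) H \<Longrightarrow> carrier G \<subseteq> carrier H \<Longrightarrow> carrier H = carrier G"
    using assms by (auto simp: maximal_subgroup_of_semigroup_def subgroup_of_semigroup_def)
  define e where "e = \<one>\<^bsub>G\<^esub>"
  show ide: "idem \<one>\<^bsub>G\<^esub>" using sub op[of "\<one>\<^bsub>G\<^esub>" "\<one>\<^bsub>G\<^esub>"] by auto
  have ee: "idem e" using ide by (simp add: e_def)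
  define H where "H = {x \<in> S. x \<cdot> x\<^sup>\<star> = e \<and> x\<^sup>\<star> \<cdot> x = e}"
  have unit: "e \<cdot> x = x" "x \<cdot> e = x" if "x \<in> H" for x
    using that by (auto simp: H_def) (metis assoc sinv(1) sinv(2) , metis sinv_cancel(1))
  have Hmult: "x \<cdot> y \<in> H" if "x \<in> H" "y \<in> H" for x y
  proof -
    have x: "x \<in> S" "x \<cdot> x\<^sup>\<star> = e" "x\<^sup>\<star> \<cdot> x = e" "y \<in> S" "y \<cdot> y\<^sup>\<star> = e" "y\<^sup>\<star> \<cdot> y = e"
      using that by (auto simp: H_def)
    have "x \<cdot> y \<cdot> (y\<^sup>\<star> \<cdot> x\<^sup>\<star>) = x \<cdot> (y \<cdot> y\<^sup>\<star>) \<cdot> x\<^sup>\<star>" "y\<^sup>\<star> \<cdot> x\<^sup>\<star> \<cdot> (x \<cdot> y) = y\<^sup>\<star> \<cdot> (x\<^sup>\<star> \<cdot> x) \<cdot> y"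
      using x(1,4) by (simp_all add: assoc)
    moreover have "y\<^sup>\<star> \<cdot> e = y\<^sup>\<star>" using x(4,5) sinv_cancel(2) by metis
    ultimately show ?thesis
      using x unit(2)[OF that(1)] by (simp add: H_def sinv_mult)
  qed
  let ?H = "\<lparr>carrier = H, monoid.mult = (\<cdot>), one = e\<rparr>"
  have "group ?H"
  proof (rule groupI)
    show "\<one>\<^bsub>?H\<^esub> \<in> carrier ?H" using ee sinv_idem[OF ee] by (simp add: H_def)
    show "\<exists>y\<in>carrier ?H. y \<otimes>\<^bsub>?H\<^esub> x = \<one>\<^bsub>?H\<^esub>" if "x \<in> carrier ?H" for x
      using that by (intro bexI[of _ "x\<^sup>\<star>"]) (auto simp: H_def)
    show "\<And>x y z. \<lbrakk>x \<in> carrier ?H; y \<in> carrier ?H; z \<in> carrier ?H\<rbrakk>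
      \<Longrightarrow> x \<otimes>\<^bsub>?H\<^esub> y \<otimes>\<^bsub>?H\<^esub> z = x \<otimes>\<^bsub>?H\<^esub> (y \<otimes>\<^bsub>?H\<^esub> z)"
      by (auto simp: H_def assoc)
  qed (use Hmult unit in auto)
  then have "subgroup_of_semigroup S (\<cdot>) ?H"
    by (auto simp: subgroup_of_semigroup_def H_def)
  moreover have "carrier G \<subseteq> H"
  proof
    fix x assume x: "x \<in> carrier G"
    let ?y = "inv\<^bsub>G\<^esub> x"
    have "x \<otimes>\<^bsub>G\<^esub> ?y = e" "?y \<otimes>\<^bsub>G\<^esub> x = e" "e \<otimes>\<^bsub>G\<^esub> x = x" "e \<otimes>\<^bsub>G\<^esub> ?y = ?y" "e \<in> carrier G"
      using x by (simp_all add: e_def)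
    then have xy: "x \<cdot> ?y = e" "?y \<cdot> x = e" "e \<cdot> x = x" "e \<cdot> ?y = ?y"
      using x op by auto
    have "x\<^sup>\<star> = ?y" by (rule sinv_eqI) (use x sub xy in auto)
    then show "x \<in> H" using x sub xy by (auto simp: H_def)
  qed
  ultimately have "H = carrier G" using max[of ?H] by simp
  then show "carrier G = {x \<in> S. x \<cdot> x\<^sup>\<star> = \<one>\<^bsub>G\<^esub> \<and> x\<^sup>\<star> \<cdot> x = \<one>\<^bsub>G\<^esub>}"
    by (simp add: H_def e_def)
qed

end

section \<open>The semilattice of idempotents\<close>

lemma strict_mono_range_atLeast:
  fixes g :: "nat \<Rightarrow> nat"
  assumes "strict_mono g" "range g = {c..}"
  shows "g n = n + c"
proof (induction n)
  case 0
  obtain k where "g k = c" using assms(2) by (metis UNIV_I atLeast_iff image_iff order_refl)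
  moreover have "g 0 \<le> g k" using assms(1) by (simp add: strict_mono_less_eq)
  moreover have "c \<le> g 0" using assms(2) by auto
  ultimately show ?case by simp
next
  case (Suc n)
  have "Suc n + c \<in> range g" using assms(2) by simp
  then obtain k where k: "g k = Suc n + c" by auto
  then have "g n < g k" using Suc by simp
  then have "Suc n \<le> k" using assms(1) by (simp add: strict_mono_less)
  then have "g (Suc n) \<le> g k" using assms(1) by (simp add: strict_mono_less_eq)
  moreover have "g n < g (Suc n)" using assms(1) by (simp add: strict_mono_less)
  ultimately show ?case using Suc k by simp
qed

text \<open>The enumeration \<open>E\<close> lists the nonzero idempotents in descending order.\<close>

locale zero_bisimple_omega = inverse_semigroup S f
  for S :: "'a set" and f (infixl "\<cdot>" 70) +
  fixes z :: 'a and E :: "nat \<Rightarrow> 'a"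
  assumes zero: "zero_of_semigroup S (\<cdot>) z"
    and E_bij: "bij_betw E UNIV (idempotents S (\<cdot>) - {z})"
    and E_order: "\<And>m n. idem_le (\<cdot>) (E m) (E n) \<longleftrightarrow> n \<le> m"
begin

lemma z_closed [simp]: "z \<in> S" and zero_mult [simp]: "x \<in> S \<Longrightarrow> z \<cdot> x = z" "x \<in> S \<Longrightarrow> x \<cdot> z = z"
  using zero by (auto simp: zero_of_semigroup_def)

lemma E_idem: "idem (E n)" and E_nonzero [simp]: "E n \<noteq> z"
  using E_bij bij_betwE[OF E_bij] by (auto simp: idempotents_def)

lemma E_closed [simp]: "E n \<in> S" using E_idem by simp

lemma E_inj [simp]: "E m = E n \<longleftrightarrow> m = n"
  using E_bij by (auto simp: bij_betw_def inj_on_def)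

lemma ex_E: "idem e \<Longrightarrow> e \<noteq> z \<Longrightarrow> \<exists>n. e = E n"
  using E_bij by (auto simp: bij_betw_def idempotents_def)

lemma E_mult [simp]: "E m \<cdot> E n = E (max m n)"
proof -
  have "E k \<cdot> E l = E l" "E l \<cdot> E k = E l" if "k \<le> l" for k l
    using E_order[of l k] that by (auto simp: idem_le_def)
  then show ?thesis by (cases "m \<le> n") (simp_all add: max_def)
qed

lemma E_mult_left [simp]: "x \<in> S \<Longrightarrow> E m \<cdot> (E n \<cdot> x) = E (max m n) \<cdot> x"
  by (simp flip: assoc)

lemma ex_E_sinv:
  assumes "x \<in> S" "x \<noteq> z"
  shows "\<exists>i. x \<cdot> x\<^sup>\<star> = E i" "\<exists>j. x\<^sup>\<star> \<cdot> x = E j"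
proof -
  have "x \<cdot> x\<^sup>\<star> \<noteq> z" "x\<^sup>\<star> \<cdot> x \<noteq> z"
    using sinv_cancel(1)[OF assms(1)] sinv(2)[OF assms(1)] assms zero_mult by metis+
  then show "\<exists>i. x \<cdot> x\<^sup>\<star> = E i" "\<exists>j. x\<^sup>\<star> \<cdot> x = E j"
    using ex_E[OF idem_mult_sinv[OF assms(1)]] ex_E[OF idem_sinv_mult[OF assms(1)]] by auto
qed

text \<open>The largest idempotent \<open>E 0\<close> fixes the idempotents \<open>x \<cdot> x\<^sup>\<star>\<close> and \<open>x\<^sup>\<star> \<cdot> x\<close>, hence \<open>x\<close>.\<close>

lemma E0_unit [simp]:
  assumes "x \<in> S"
  shows "E 0 \<cdot> x = x" "x \<cdot> E 0 = x"
proof -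
  have "E 0 \<cdot> x = x \<and> x \<cdot> E 0 = x" if nz: "x \<noteq> z"
  proof -
    obtain i j where ij: "x \<cdot> x\<^sup>\<star> = E i" "x\<^sup>\<star> \<cdot> x = E j" using ex_E_sinv[OF assms nz] by auto
    then have x: "E i \<cdot> x = x" "x \<cdot> E j = x"
      using sinv(2)[OF assms] sinv_cancel(1)[OF assms] by simp_all
    have "E 0 \<cdot> (E i \<cdot> x) = E i \<cdot> x" "x \<cdot> E j \<cdot> E 0 = x \<cdot> E j"
      using assms by (simp, simp add: assoc)
    then show ?thesis by (simp add: x)
  qed
  then show "E 0 \<cdot> x = x" "x \<cdot> E 0 = x" by (cases "x = z"; simp)+
qed

text \<open>Conjugation by \<open>u\<close> is an order isomorphism of the chain of nonzero idempotents onto the part of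
  it below \<open>E c\<close>, and between such chains there is only one order isomorphism.\<close>

lemma conjugate_E:
  assumes u: "u \<in> S" and d: "u\<^sup>\<star> \<cdot> u = E 0" and r: "u \<cdot> u\<^sup>\<star> = E c"
  shows "u \<cdot> E n \<cdot> u\<^sup>\<star> = E (n + c)"
proof -
  have d': "u\<^sup>\<star> \<cdot> (u \<cdot> x) = x" if "x \<in> S" for x
    using that u d by (simp flip: assoc)
  have r': "u \<cdot> (u\<^sup>\<star> \<cdot> x) = E c \<cdot> x" if "x \<in> S" for x
    using that u r by (simp flip: assoc)
  have conj_back: "u\<^sup>\<star> \<cdot> (u \<cdot> E n \<cdot> u\<^sup>\<star>) \<cdot> u = E n" for n
    using u d by (simp add: assoc d')
  have "\<exists>m. u \<cdot> E n \<cdot> u\<^sup>\<star> = E m" for n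
  proof (rule ex_E)
    show "idem (u \<cdot> E n \<cdot> u\<^sup>\<star>)" using u by (simp add: assoc d')
    show "u \<cdot> E n \<cdot> u\<^sup>\<star> \<noteq> z"
    proof
      assume "u \<cdot> E n \<cdot> u\<^sup>\<star> = z"
      then show False using conj_back[of n] E_nonzero[of n] u by simp
    qed
  qed
  then obtain g where g: "\<And>n. u \<cdot> E n \<cdot> u\<^sup>\<star> = E (g n)" by metis
  have inj: "g m = g n \<Longrightarrow> m = n" for m n
    using conj_back g E_inj by metis
  have "strict_mono g"
  proof (rule strict_monoI)
    fix m n :: nat assume mn: "m < n"
    have "E (g m) \<cdot> E (g n) = u \<cdot> (E m \<cdot> E n) \<cdot> u\<^sup>\<star>"
      unfolding g[symmetric] using u by (simp add: assoc d')
    also have "E m \<cdot> E n = E n" using mn by simp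
    finally have "max (g m) (g n) = g n" by (simp add: g)
    then have "g m \<le> g n" by simp
    then show "g m < g n" using inj mn by (metis nat_less_le)
  qed
  moreover have "range g = {c..}"
  proof (intro equalityI subsetI)
    fix m assume "m \<in> range g"
    then obtain n where n: "m = g n" by auto
    have "E c \<cdot> (u \<cdot> E n \<cdot> u\<^sup>\<star>) = u \<cdot> E n \<cdot> u\<^sup>\<star>"
      unfolding r[symmetric] using u by (simp add: assoc)
    then have "max c (g n) = g n" by (simp add: g)
    then show "m \<in> {c..}" using n by simp
  next
    fix m assume "m \<in> {c..}"
    then have m: "max c m = m" "max m c = m" by auto
    have fwd: "u \<cdot> (u\<^sup>\<star> \<cdot> E m \<cdot> u) \<cdot> u\<^sup>\<star> = E m"
      using u m r by (simp add: assoc r')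
    have "\<exists>n. u\<^sup>\<star> \<cdot> E m \<cdot> u = E n"
    proof (rule ex_E)
      show "idem (u\<^sup>\<star> \<cdot> E m \<cdot> u)" using u m by (simp add: assoc r')
      show "u\<^sup>\<star> \<cdot> E m \<cdot> u \<noteq> z"
      proof
        assume "u\<^sup>\<star> \<cdot> E m \<cdot> u = z"
        then show False using fwd E_nonzero[of m] u by simp
      qed
    qed
    then show "m \<in> range g" using fwd g E_inj by (metis rangeI)
  qed
  ultimately show ?thesis using g strict_mono_range_atLeast by metis
qed

end

text \<open>\<open>E 1\<close> and \<open>E 0\<close> lie in the same \<open>\<D>\<close>-class; the element linking them through \<open>\<L>\<close> and
  \<open>\<R>\<close> is the generator \<open>a\<close>.\<close>

lemma zero_bisimple_omega_semigroupE:
  assumes "zero_bisimple_omega_semigroup S f z"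
  obtains E a where "zero_bisimple_omega S f z E" "a \<in> S"
    "f a (inverse_semigroup.sinv S f a) = E 0" "f (inverse_semigroup.sinv S f a) a = E 1"
proof -
  from assms obtain \<phi> where inv: "inverse_semigroup_on S f" and z: "zero_of_semigroup S f z"
    and D: "S // green_D S f = {S - {z}, {z}}"
    and bij: "bij_betw \<phi> {..0::int} (idempotents S f - {z})"
    and ord: "\<And>m n. m \<le> 0 \<Longrightarrow> n \<le> 0 \<Longrightarrow> m \<le> n \<longleftrightarrow> idem_le f (\<phi> m) (\<phi> n)"
    unfolding zero_bisimple_omega_semigroup_def by auto
  define E where "E = (\<lambda>n. \<phi> (- int n))"
  have "bij_betw (\<lambda>n. - int n) UNIV {..0}"
    by (rule bij_betwI[where g = "\<lambda>m. nat (- m)"]) auto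
  from bij_betw_trans[OF this bij] have "bij_betw E UNIV (idempotents S f - {z})"
    by (simp add: E_def comp_def)
  then interpret zero_bisimple_omega S f z E
    by unfold_locales (use inv z in \<open>auto simp: E_def simp flip: ord\<close>)
  have "green_D S f `` {E 1} \<in> S // green_D S f" by (rule quotientI) simp
  moreover have "E 1 \<in> green_D S f `` {E 1}"
    by (auto simp: green_D_def green_L_def green_R_def intro!: relcompI[of _ "E 1"])
  ultimately have "green_D S f `` {E 1} = S - {z}"
    unfolding D by (metis E_nonzero insertE singletonD)
  then have "E 0 \<in> green_D S f `` {E 1}" by simp
  then have "(E 1, E 0) \<in> green_D S f" by (simp only: Image_singleton_iff)
  then obtain c where "(E 1, c) \<in> green_L S f" and R: "(c, E 0) \<in> green_R S f"
    by (auto simp: green_D_def)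
  then have L: "(c, E 1) \<in> green_L S f" by (auto simp: green_L_def)
  show thesis
    using that[OF zero_bisimple_omega_axioms] green_L_idem[OF L E_idem] green_R_idem[OF R E_idem] by blast
qed

section \<open>Reilly coordinates\<close>

text \<open>The element \<open>a\<close> and its inverse \<open>b\<close> generate a bicyclic monoid containing all nonzero
  idempotents.\<close>

locale reilly_coordinates = zero_bisimple_omega S f z E
  for S :: "'a set" and f (infixl "\<cdot>" 70) and z E +
  fixes a b :: 'a
  assumes a_closed [simp]: "a \<in> S" and b_def: "b = a\<^sup>\<star>"
    and ab: "a \<cdot> b = E 0" and ba: "b \<cdot> a = E 1"
begin

lemma b_closed [simp]: "b \<in> S" by (simp add: b_def)

definition pow :: "'a \<Rightarrow> nat \<Rightarrow> 'a" where "pow x n = ((\<cdot>) x ^^ n) (E 0)"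

lemma pow_0 [simp]: "pow x 0 = E 0" and pow_Suc: "pow x (Suc n) = x \<cdot> pow x n"
  by (simp_all add: pow_def)

lemma pow_closed [simp]: "x \<in> S \<Longrightarrow> pow x n \<in> S"
  by (induction n) (auto simp: pow_Suc)

lemma pow_add: "x \<in> S \<Longrightarrow> pow x (m + n) = pow x m \<cdot> pow x n"
  by (induction m) (auto simp: pow_Suc assoc)

lemma pow_1 [simp]: "x \<in> S \<Longrightarrow> pow x (Suc 0) = x"
  by (simp add: pow_Suc)

lemma pow_Suc': "x \<in> S \<Longrightarrow> pow x (Suc n) = pow x n \<cdot> x"
  using pow_add[of x n "Suc 0"] by simp

lemma sinv_pow: "x \<in> S \<Longrightarrow> (pow x n)\<^sup>\<star> = pow (x\<^sup>\<star>) n"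
proof (induction n)
  case (Suc n)
  then show ?case by (simp add: pow_Suc[of x] pow_Suc'[of "x\<^sup>\<star>"] sinv_mult)
qed (simp add: sinv_idem E_idem)

lemma sinv_pow_a [simp]: "(pow a n)\<^sup>\<star> = pow b n" and sinv_pow_b [simp]: "(pow b n)\<^sup>\<star> = pow a n"
  using sinv_pow[of a n] sinv_pow[of b n] by (simp_all add: b_def)

lemma ab_left [simp]: "x \<in> S \<Longrightarrow> a \<cdot> (b \<cdot> x) = x"
  using ab by (simp flip: assoc)

lemma ba_left: "x \<in> S \<Longrightarrow> b \<cdot> (a \<cdot> x) = E 1 \<cdot> x"
  using ba by (simp flip: assoc)

lemma pow_a_pow_b [simp]: "pow a n \<cdot> pow b n = E 0"
proof (induction n)
  case (Suc n)
  have "pow a (Suc n) \<cdot> pow b (Suc n) = pow a n \<cdot> (a \<cdot> (b \<cdot> pow b n))"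
    unfolding pow_Suc'[OF a_closed] pow_Suc[of b] by (simp add: assoc)
  then show ?case using Suc by simp
qed simp

lemma pow_b_pow_a [simp]: "pow b n \<cdot> pow a n = E n"
proof (induction n)
  case (Suc n)
  have "pow b (Suc n) \<cdot> pow a (Suc n) = b \<cdot> (pow b n \<cdot> pow a n) \<cdot> a"
    unfolding pow_Suc'[OF a_closed] pow_Suc[of b] by (simp add: assoc)
  also have "\<dots> = b \<cdot> E n \<cdot> b\<^sup>\<star>" by (simp add: Suc) (simp add: b_def)
  also have "\<dots> = E (n + 1)"
    by (rule conjugate_E) (use ab ba in \<open>simp_all add: b_def\<close>)
  finally show ?case by simp
qed simp

lemma pow_cancel [simp]:
  assumes "x \<in> S"
  shows "pow a n \<cdot> (pow b n \<cdot> x) = x" "pow b n \<cdot> (pow a n \<cdot> x) = E n \<cdot> x"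
  using assms by (simp_all flip: assoc)

lemma pow_a_E: "pow a n \<cdot> E n = pow a n" and pow_b_E: "E n \<cdot> pow b n = pow b n"
proof -
  have "pow a n \<cdot> (pow b n \<cdot> pow a n) = pow a n" by (subst assoc[symmetric]) simp_all
  then show "pow a n \<cdot> E n = pow a n" by simp
  have "pow b n \<cdot> pow a n \<cdot> pow b n = pow b n" by (subst assoc) simp_all
  then show "E n \<cdot> pow b n = pow b n" by simp
qed

text \<open>The intersection of the \<open>\<R>\<close>-class of \<open>E i\<close> with the \<open>\<L>\<close>-class of \<open>E j\<close>.\<close>

definition Hclass :: "nat \<Rightarrow> nat \<Rightarrow> 'a set" where
  "Hclass i j = {x \<in> S. x \<cdot> x\<^sup>\<star> = E i \<and> x\<^sup>\<star> \<cdot> x = E j}"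

lemma Hclass_closed: "x \<in> Hclass i j \<Longrightarrow> x \<in> S"
  by (simp add: Hclass_def)

lemma z_notin_Hclass [simp]: "z \<notin> Hclass i j"
proof
  assume "z \<in> Hclass i j"
  then have "z \<cdot> z\<^sup>\<star> = E i" unfolding Hclass_def by blast
  moreover have "z \<cdot> z\<^sup>\<star> = z" by simp
  ultimately show False using E_nonzero[of i] by metis
qed

lemma Hclass_unit:
  assumes "x \<in> Hclass i j"
  shows "E i \<cdot> x = x" "x \<cdot> E j = x"
  using assms sinv(2)[of x] sinv_cancel(1)[of x] by (auto simp: Hclass_def)

lemma Hclass_disjoint: "x \<in> Hclass i j \<Longrightarrow> x \<in> Hclass i' j' \<Longrightarrow> i = i' \<and> j = j'"
  by (auto simp: Hclass_def)

lemma ex_Hclass: "x \<in> S \<Longrightarrow> x \<noteq> z \<Longrightarrow> \<exists>i j. x \<in> Hclass i j"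
  using ex_E_sinv by (auto simp: Hclass_def)

lemma Hclass_mult_iff:
  assumes "x \<in> Hclass i j"
  shows "E n \<cdot> x = x \<longleftrightarrow> n \<le> i" "x \<cdot> E n = x \<longleftrightarrow> n \<le> j"
proof -
  have x: "x \<in> S" "x \<cdot> x\<^sup>\<star> = E i" "x\<^sup>\<star> \<cdot> x = E j" using assms by (auto simp: Hclass_def)
  have "E n \<cdot> E i = E i" if "E n \<cdot> x = x"
    using that x(1) by (simp add: that flip: x(2) assoc)
  moreover have "E n \<cdot> x = x" if "E n \<cdot> E i = E i"
    using that x(1) Hclass_unit(1)[OF assms] by (metis E_closed assoc)
  ultimately show "E n \<cdot> x = x \<longleftrightarrow> n \<le> i" by auto
  have "E j \<cdot> E n = E j" if "x \<cdot> E n = x"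
    using that x(1) by (simp add: that assoc flip: x(3))
  moreover have "x \<cdot> E n = x" if "E j \<cdot> E n = E j"
    using that x(1) Hclass_unit(2)[OF assms] by (metis E_closed assoc)
  ultimately show "x \<cdot> E n = x \<longleftrightarrow> n \<le> j" by auto
qed

text \<open>All these classes are translates of each other: multiplying by powers of \<open>a\<close> and \<open>b\<close> changes the
  two indices independently.\<close>

lemma Hclass_shift:
  assumes x: "x \<in> Hclass i j"
  shows "pow b i' \<cdot> pow a i \<cdot> x \<cdot> pow b j \<cdot> pow a j' \<in> Hclass i' j'"
proof -
  have x': "x \<in> S" "x \<cdot> x\<^sup>\<star> = E i" "x\<^sup>\<star> \<cdot> x = E j" using x by (auto simp: Hclass_def)
  have u: "E j \<cdot> (x\<^sup>\<star> \<cdot> w) = x\<^sup>\<star> \<cdot> w" "E i \<cdot> (x \<cdot> w) = x \<cdot> w" if "w \<in> S" for w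
    using that x' by (simp_all add: assoc flip: x'(2,3))
  have xx: "x \<cdot> (x\<^sup>\<star> \<cdot> w) = E i \<cdot> w" "x\<^sup>\<star> \<cdot> (x \<cdot> w) = E j \<cdot> w" if "w \<in> S" for w
    using that x' by (simp_all flip: assoc)
  have aE: "pow a n \<cdot> (E n \<cdot> w) = pow a n \<cdot> w" if "w \<in> S" for n w
    using that by (metis E_closed a_closed assoc pow_a_E pow_closed)
  show ?thesis
    using x' by (simp add: Hclass_def sinv_mult assoc u xx aE)
qed

text \<open>Conjugation by a unit fixes every idempotent, by \<open>conjugate_E\<close> with \<open>c = 0\<close>.\<close>

lemma Hclass_commute_E:
  assumes x: "x \<in> Hclass 0 0"
  shows "x \<cdot> E n = E n \<cdot> x"
proof -
  have x': "x \<in> S" "x \<cdot> x\<^sup>\<star> = E 0" "x\<^sup>\<star> \<cdot> x = E 0" using x by (auto simp: Hclass_def)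
  have "x \<cdot> E n \<cdot> x\<^sup>\<star> \<cdot> x = E n \<cdot> x" using conjugate_E[OF x'(1,3,2), of n] by simp
  then show ?thesis using x' by (simp add: assoc)
qed

end

text \<open>Coordinates with respect to an arbitrary maximal subgroup \<open>Hclass k k\<close>: the map \<open>lift\<close>
  identifies it with the group of units.\<close>

locale reilly_group = reilly_coordinates S f z E a b
  for S :: "'a set" and f (infixl "\<cdot>" 70) and z E a b +
  fixes G :: "'a monoid" and k :: nat
  assumes G_carrier: "carrier G = Hclass k k"
    and G_mult: "\<And>x y. x \<in> carrier G \<Longrightarrow> y \<in> carrier G \<Longrightarrow> x \<otimes>\<^bsub>G\<^esub> y = x \<cdot> y"
    and G_group: "group G"
begin

lemma G_closed [simp]: "s \<in> carrier G \<Longrightarrow> s \<in> S"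
  by (simp add: G_carrier Hclass_closed)

definition lift :: "'a \<Rightarrow> 'a" where "lift s = pow a k \<cdot> s \<cdot> pow b k"

lemma lift_Hclass: "s \<in> carrier G \<Longrightarrow> lift s \<in> Hclass 0 0"
  using Hclass_shift[of s k k 0 0] by (simp add: G_carrier lift_def assoc Hclass_closed)

lemma lift_closed [simp]: "s \<in> S \<Longrightarrow> lift s \<in> S"
  by (simp add: lift_def)

lemma lift_mult:
  assumes "s \<in> carrier G" "t \<in> carrier G"
  shows "lift (s \<otimes>\<^bsub>G\<^esub> t) = lift s \<cdot> lift t"
proof -
  have "E k \<cdot> (t \<cdot> pow b k) = t \<cdot> pow b k"
    using Hclass_unit(1)[of t k k] assms by (simp add: G_carrier Hclass_closed flip: assoc)
  then show ?thesis using assms by (simp add: lift_def G_mult assoc)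
qed

definition unlift :: "'a \<Rightarrow> 'a" where "unlift t = pow b k \<cdot> t \<cdot> pow a k"

lemma unlift_carrier: "t \<in> Hclass 0 0 \<Longrightarrow> unlift t \<in> carrier G"
  using Hclass_shift[of t 0 0 k k] by (simp add: G_carrier unlift_def assoc Hclass_closed)

lemma lift_unlift: "t \<in> S \<Longrightarrow> lift (unlift t) = t"
  by (simp add: lift_def unlift_def assoc)

lemma unlift_lift: "s \<in> carrier G \<Longrightarrow> unlift (lift s) = s"
  using Hclass_unit[of s k k] by (simp add: lift_def unlift_def assoc G_carrier Hclass_closed)

text \<open>Reilly's endomorphism \<open>s \<mapsto> a s b\<close> of the group of units, transported to \<open>G\<close>.\<close>

definition endo :: "'a \<Rightarrow> 'a" where "endo s = unlift (a \<cdot> lift s \<cdot> b)"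

text \<open>The factor \<open>b \<cdot> a = E 1\<close> that appears between two units commutes with them and is absorbed by
  \<open>a \<cdot> b = E 0\<close>.\<close>

lemma a_conj_Hclass:
  assumes "t \<in> Hclass 0 0"
  shows "a \<cdot> t \<cdot> b \<in> Hclass 0 0"
proof -
  have t: "t \<in> S" "t \<cdot> t\<^sup>\<star> = E 0" "t\<^sup>\<star> \<cdot> t = E 0" using assms by (auto simp: Hclass_def)
  have tt: "t \<cdot> (t\<^sup>\<star> \<cdot> w) = w" "t\<^sup>\<star> \<cdot> (t \<cdot> w) = w" if "w \<in> S" for w
    using that t by (simp_all flip: assoc)
  have ts: "t\<^sup>\<star> \<in> Hclass 0 0" using t by (simp add: Hclass_def)
  have c: "b \<cdot> (a \<cdot> (u \<cdot> w)) = u \<cdot> (b \<cdot> (a \<cdot> w))" if "u \<in> Hclass 0 0" "w \<in> S" for u w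
  proof -
    have "u \<cdot> E 1 \<cdot> w = E 1 \<cdot> u \<cdot> w" using Hclass_commute_E[OF that(1), of 1] by simp
    then show ?thesis using that Hclass_closed[OF that(1)] by (simp add: assoc ba_left)
  qed
  have s: "b\<^sup>\<star> = a" by (simp add: b_def)
  show ?thesis
    unfolding Hclass_def using t ab
    by (simp add: sinv_mult assoc s c[OF assms] c[OF ts] tt flip: b_def)
qed

lemma endo_carrier: "s \<in> carrier G \<Longrightarrow> endo s \<in> carrier G"
  by (simp add: endo_def unlift_carrier a_conj_Hclass lift_Hclass)

lemma lift_endo: "s \<in> carrier G \<Longrightarrow> lift (endo s) = a \<cdot> lift s \<cdot> b"
  by (simp add: endo_def lift_unlift)

lemma a_lift:
  assumes "s \<in> carrier G"
  shows "a \<cdot> lift s = lift (endo s) \<cdot> a"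
proof -
  have "a \<cdot> lift s = a \<cdot> E 1 \<cdot> lift s" using pow_a_E[of 1] by simp
  also have "\<dots> = a \<cdot> (lift s \<cdot> E 1)"
    using assms Hclass_commute_E[OF lift_Hclass[OF assms]] by (simp add: assoc)
  also have "\<dots> = lift (endo s) \<cdot> a" using assms by (simp add: lift_endo assoc ba)
  finally show ?thesis .
qed

lemma lift_b:
  assumes "s \<in> carrier G"
  shows "lift s \<cdot> b = b \<cdot> lift (endo s)"
proof -
  have "lift s \<cdot> b = lift s \<cdot> E 1 \<cdot> b" using assms pow_b_E[of 1] by (simp add: assoc)
  also have "\<dots> = E 1 \<cdot> lift s \<cdot> b" using Hclass_commute_E[OF lift_Hclass[OF assms]] by simp
  also have "\<dots> = b \<cdot> lift (endo s)" using assms by (simp add: lift_endo assoc ba_left)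
  finally show ?thesis .
qed

lemma endo_hom: "endo \<in> hom G G"
proof (rule homI)
  interpret group G by (rule G_group)
  fix s t assume st: "s \<in> carrier G" "t \<in> carrier G"
  have "lift (endo (s \<otimes>\<^bsub>G\<^esub> t)) = a \<cdot> lift s \<cdot> lift t \<cdot> b"
    using st by (simp add: lift_endo lift_mult assoc)
  also have "\<dots> = lift (endo s) \<cdot> (a \<cdot> lift t \<cdot> b)"
    using st endo_carrier by (simp add: a_lift assoc)
  also have "\<dots> = lift (endo s \<otimes>\<^bsub>G\<^esub> endo t)"
    using st by (simp add: lift_mult endo_carrier lift_endo[of t])
  finally show "endo (s \<otimes>\<^bsub>G\<^esub> t) = endo s \<otimes>\<^bsub>G\<^esub> endo t"
    using st by (metis endo_carrier m_closed unlift_lift)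
qed (simp add: endo_carrier)

lemma endo_funpow_carrier: "s \<in> carrier G \<Longrightarrow> (endo ^^ n) s \<in> carrier G"
  by (induction n) (auto simp: endo_carrier)

lemma pow_a_lift: "s \<in> carrier G \<Longrightarrow> pow a n \<cdot> lift s = lift ((endo ^^ n) s) \<cdot> pow a n"
proof (induction n)
  case (Suc n)
  then have "pow a (Suc n) \<cdot> lift s = a \<cdot> lift ((endo ^^ n) s) \<cdot> pow a n"
    by (simp add: pow_Suc assoc endo_funpow_carrier)
  also have "\<dots> = lift ((endo ^^ Suc n) s) \<cdot> pow a (Suc n)"
    using Suc by (simp add: a_lift endo_funpow_carrier endo_carrier pow_Suc assoc)
  finally show ?case .
qed simp

lemma lift_pow_b: "s \<in> carrier G \<Longrightarrow> lift s \<cdot> pow b n = pow b n \<cdot> lift ((endo ^^ n) s)"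
proof (induction n)
  case (Suc n)
  then have "lift s \<cdot> pow b (Suc n) = pow b n \<cdot> (lift ((endo ^^ n) s) \<cdot> b)"
    by (simp add: pow_Suc' endo_funpow_carrier flip: assoc)
  also have "\<dots> = pow b (Suc n) \<cdot> lift ((endo ^^ Suc n) s)"
    using Suc by (simp add: lift_b endo_funpow_carrier endo_carrier pow_Suc' assoc)
  finally show ?case .
qed simp

definition coord :: "nat \<times> 'a \<times> nat \<Rightarrow> 'a" where
  "coord = (\<lambda>(i, s, j). pow b i \<cdot> lift s \<cdot> pow a j)"

lemma coord_eq: "coord (i, s, j) = pow b i \<cdot> lift s \<cdot> pow a j"
  by (simp add: coord_def)

lemma coord_Hclass: "s \<in> carrier G \<Longrightarrow> coord (i, s, j) \<in> Hclass i j"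
  using Hclass_shift[of s k k i j] by (simp add: G_carrier lift_def coord_eq assoc Hclass_closed)

lemma coord_closed [simp]: "s \<in> carrier G \<Longrightarrow> coord (i, s, j) \<in> S"
  using coord_Hclass Hclass_closed by blast

lemma coord_nonzero [simp]: "s \<in> carrier G \<Longrightarrow> coord (i, s, j) \<noteq> z"
  using coord_Hclass z_notin_Hclass by metis

definition group_part :: "nat \<Rightarrow> nat \<Rightarrow> 'a \<Rightarrow> 'a" where
  "group_part i j x = unlift (pow a i \<cdot> x \<cdot> pow b j)"

lemma group_part_carrier: "x \<in> Hclass i j \<Longrightarrow> group_part i j x \<in> carrier G"
  using Hclass_shift[of x i j 0 0] by (simp add: group_part_def unlift_carrier assoc Hclass_closed)

lemma group_part_coord: "s \<in> carrier G \<Longrightarrow> group_part i j (coord (i, s, j)) = s"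
  by (simp add: group_part_def coord_eq assoc unlift_lift)

lemma coord_group_part: "x \<in> Hclass i j \<Longrightarrow> coord (i, group_part i j x, j) = x"
  using Hclass_unit[of x i j] by (simp add: coord_eq group_part_def lift_unlift assoc Hclass_closed)

lemma coord_image: "(\<lambda>s. coord (i, s, j)) ` carrier G = Hclass i j"
  using coord_Hclass coord_group_part group_part_carrier by (force simp: image_iff)

lemma coord_inj:
  assumes "s \<in> carrier G" "t \<in> carrier G" "coord (i, s, j) = coord (m, t, n)"
  shows "i = m \<and> s = t \<and> j = n"
  using assms Hclass_disjoint coord_Hclass group_part_coord by metis

text \<open>The powers of \<open>a\<close> and \<open>b\<close> in the middle cancel up to a single power of one of them, which is then
  moved outwards past a unit at the price of iterating the endomorphism.\<close>

lemma coord_mult: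
  assumes s: "s \<in> carrier G" and t: "t \<in> carrier G"
  shows "coord (i, s, j) \<cdot> coord (m, t, n) = coord (reilly_mult G endo (i, s, j) (m, t, n))"
proof (cases "m \<le> j")
  case True
  then obtain d where j: "j = d + m" by (metis add.commute le_Suc_ex)
  have "coord (i, s, j) \<cdot> coord (m, t, n) = pow b i \<cdot> lift s \<cdot> (pow a d \<cdot> lift t) \<cdot> pow a n"
    using s t by (simp add: coord_eq j pow_add assoc)
  also have "\<dots> = pow b i \<cdot> (lift s \<cdot> lift ((endo ^^ d) t)) \<cdot> pow a (d + n)"
    using s t by (simp add: pow_a_lift pow_add assoc endo_funpow_carrier)
  finally show ?thesis
    using s t by (simp add: coord_eq lift_mult endo_funpow_carrier j)
next
  case False
  then obtain d where m: "m = j + d" by (metis le_Suc_ex nat_le_linear)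
  have "coord (i, s, j) \<cdot> coord (m, t, n) = pow b i \<cdot> (lift s \<cdot> pow b d) \<cdot> lift t \<cdot> pow a n"
    using s t by (simp add: coord_eq m pow_add assoc)
  also have "\<dots> = pow b (i + d) \<cdot> (lift ((endo ^^ d) s) \<cdot> lift t) \<cdot> pow a n"
    using s t by (simp add: lift_pow_b pow_add assoc endo_funpow_carrier)
  finally show ?thesis
    using s t by (simp add: coord_eq lift_mult endo_funpow_carrier m)
qed

text \<open>Translations by \<open>a\<close> and \<open>b\<close> move between neighbouring classes without changing the group
  coordinate. Left translation by \<open>a\<close> on \<open>Hclass 0 j\<close> is the exception: there the endomorphism enters.\<close>

lemma coord_shift:
  assumes "s \<in> carrier G"
  shows "a \<cdot> coord (Suc i, s, j) = coord (i, s, j)"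
    and "b \<cdot> coord (i, s, j) = coord (Suc i, s, j)"
    and "coord (i, s, j) \<cdot> a = coord (i, s, Suc j)"
    and "coord (i, s, Suc j) \<cdot> b = coord (i, s, j)"
proof -
  show "a \<cdot> coord (Suc i, s, j) = coord (i, s, j)" "b \<cdot> coord (i, s, j) = coord (Suc i, s, j)"
    using assms by (simp_all add: coord_eq pow_Suc assoc)
  show "coord (i, s, j) \<cdot> a = coord (i, s, Suc j)" "coord (i, s, Suc j) \<cdot> b = coord (i, s, j)"
    using assms ab by (simp_all add: coord_eq pow_Suc' assoc)
qed

text \<open>In the row \<open>i = 0\<close> no power of \<open>b\<close> separates the group coordinate from a unit on the left, so the
  unit acts on it by plain multiplication.\<close>

lemma lift_coord: "g \<in> carrier G \<Longrightarrow> s \<in> carrier G \<Longrightarrow> lift g \<cdot> coord (0, s, j) = coord (0, g \<otimes>\<^bsub>G\<^esub> s, j)"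
  by (simp add: coord_eq lift_mult assoc)

primrec coord0 :: "(nat \<times> 'a \<times> nat) option \<Rightarrow> 'a" where
  "coord0 None = z"
| "coord0 (Some p) = coord p"

lemma bij_betw_coord0: "bij_betw coord0 (reilly0_carrier (carrier G)) S"
  unfolding bij_betw_def
proof
  show "inj_on coord0 (reilly0_carrier (carrier G))"
    by (auto simp: inj_on_def reilly0_carrier_def not_sym[OF coord_nonzero] dest: coord_inj)
  show "coord0 ` reilly0_carrier (carrier G) = S"
  proof (intro equalityI subsetI)
    fix x assume x: "x \<in> S"
    show "x \<in> coord0 ` reilly0_carrier (carrier G)"
    proof (cases "x = z")
      case False
      then obtain i j where "x \<in> Hclass i j" using ex_Hclass x by blast
      then have "x = coord0 (Some (i, group_part i j x, j))" "group_part i j x \<in> carrier G"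
        by (simp_all add: coord_group_part group_part_carrier)
      then show ?thesis by (force simp: reilly0_carrier_def)
    qed (force simp: reilly0_carrier_def)
  qed (auto simp: reilly0_carrier_def)
qed

lemma coord0_mult:
  assumes "p \<in> reilly0_carrier (carrier G)" "q \<in> reilly0_carrier (carrier G)"
  shows "coord0 (reilly0_mult G endo p q) = coord0 p \<cdot> coord0 q"
  using assms by (auto simp: reilly0_carrier_def coord_mult simp del: reilly_mult.simps)

end
section \<open>The topology\<close>

locale topological_reilly_group = reilly_group "topspace X" f z E a b G k
  for X :: "'a topology" and f (infixl "\<cdot>" 70) and z E a b and G :: "'a monoid" and k +
  assumes continuous_left: "\<And>x. x \<in> topspace X \<Longrightarrow> continuous_map X X (\<lambda>y. x \<cdot> y)"
    and continuous_right: "\<And>x. x \<in> topspace X \<Longrightarrow> continuous_map X X (\<lambda>y. y \<cdot> x)"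
    and Hausdorff: "Hausdorff_space X"
    and compact_G: "compactin X (carrier G)"
begin

lemma continuous_sandwich:
  assumes "p \<in> topspace X" "q \<in> topspace X" "continuous_map Y X g"
  shows "continuous_map Y X (\<lambda>y. p \<cdot> g y \<cdot> q)"
  using continuous_map_compose[OF continuous_map_compose[OF assms(3) continuous_left[OF assms(1)]]
      continuous_right[OF assms(2)]]
  by (simp add: comp_def)

lemma continuous_lift: "continuous_map X X lift"
  unfolding lift_def by (intro continuous_sandwich) auto

lemma continuous_coord: "continuous_map X X (\<lambda>s. coord (i, s, j))"
  unfolding coord_eq by (intro continuous_sandwich continuous_lift) auto

lemma continuous_group_part: "continuous_map X X (group_part i j)"
  unfolding group_part_def unlift_def by (intro continuous_sandwich) auto

lemma continuous_endo:
  "continuous_map (subtopology X (carrier G)) (subtopology X (carrier G)) endo"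
proof (rule continuous_map_into_subtopology)
  have "continuous_map X X endo"
    unfolding endo_def unlift_def by (intro continuous_sandwich continuous_lift) auto
  then show "continuous_map (subtopology X (carrier G)) X endo"
    by (rule continuous_map_from_subtopology)
qed (auto simp: endo_carrier)

lemma compactin_Hclass: "compactin X (Hclass i j)"
  using image_compactin[OF compact_G continuous_coord] by (simp add: coord_image)

lemma closedin_Hclass: "closedin X (Hclass i j)"
  using compactin_imp_closedin[OF Hausdorff compactin_Hclass] .

text \<open>The sets \<open>L\<close> and \<open>R\<close> below are closed as equalizers of continuous maps into a Hausdorff space. Their
  complement is the union of the classes \<open>Hclass m n\<close> with \<open>m \<le> i\<close> and \<open>n \<le> j\<close>, a finite union of
  closed sets from which all but one member is removed.\<close>

lemma openin_Hclass: "openin X (Hclass i j)"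
proof -
  define L where "L = {x \<in> topspace X. E (Suc i) \<cdot> x = x}"
  define R where "R = {x \<in> topspace X. x \<cdot> E (Suc j) = x}"
  define B where "B = (\<Union>(m, n)\<in>{..i} \<times> {..j} - {(i, j)}. Hclass m n)"
  have "closedin X L"
    unfolding L_def using closedin_continuous_maps_eq[OF Hausdorff continuous_left[of "E (Suc i)"], of "\<lambda>x. x"]
    by simp
  moreover have "closedin X R"
    unfolding R_def using closedin_continuous_maps_eq[OF Hausdorff continuous_right[of "E (Suc j)"], of "\<lambda>x. x"]
    by simp
  moreover have "closedin X B"
    unfolding B_def by (rule closedin_Union) (auto simp: closedin_Hclass)
  ultimately have "openin X (topspace X - (L \<union> R \<union> B))"
    by (intro openin_diff closedin_Un) auto
  moreover have "topspace X - (L \<union> R \<union> B) = Hclass i j"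
  proof (intro equalityI subsetI)
    fix x assume x: "x \<in> topspace X - (L \<union> R \<union> B)"
    then have "x \<noteq> z" by (auto simp: L_def)
    then obtain m n where mn: "x \<in> Hclass m n" using x ex_Hclass by blast
    then have "m \<le> i" "n \<le> j"
      using x Hclass_mult_iff[OF mn] by (auto simp: L_def R_def not_less_eq_eq)
    then show "x \<in> Hclass i j" using x mn by (auto simp: B_def)
  next
    fix x assume x: "x \<in> Hclass i j"
    have "x \<notin> L" "x \<notin> R"
      using Hclass_mult_iff(1)[OF x, of "Suc i"] Hclass_mult_iff(2)[OF x, of "Suc j"]
      by (simp_all add: L_def R_def)
    moreover have "x \<notin> B" unfolding B_def using Hclass_disjoint[OF x] by blast
    ultimately show "x \<in> topspace X - (L \<union> R \<union> B)" using Hclass_closed[OF x] by blast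
  qed
  ultimately show ?thesis by simp
qed

lemma closedin_zero: "closedin X {z}"
  using compactin_imp_closedin[OF Hausdorff, of "{z}"] by simp

lemma coord0_in_image_iff:
  assumes "W \<subseteq> reilly0_carrier (carrier G)" "p \<in> reilly0_carrier (carrier G)"
  shows "coord0 p \<in> coord0 ` W \<longleftrightarrow> p \<in> W"
  using inj_on_image_mem_iff[OF bij_betw_imp_inj_on[OF bij_betw_coord0] assms(2,1)] .

lemma openin_coord_image:
  assumes "openin (subtopology X (carrier G)) U"
  shows "openin X ((\<lambda>s. coord (i, s, j)) ` U)"
proof -
  obtain U' where U': "openin X U'" "U = U' \<inter> carrier G"
    using assms by (auto simp: openin_subtopology)
  have "(\<lambda>s. coord (i, s, j)) ` U = {x \<in> topspace X. group_part i j x \<in> U'} \<inter> Hclass i j"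
  proof (intro equalityI subsetI)
    fix x assume x: "x \<in> {x \<in> topspace X. group_part i j x \<in> U'} \<inter> Hclass i j"
    then show "x \<in> (\<lambda>s. coord (i, s, j)) ` U"
      using coord_group_part[of x i j] group_part_carrier[of x i j] U'
      by (intro image_eqI[of _ _ "group_part i j x"]) auto
  qed (auto simp: U'(2) group_part_coord coord_Hclass)
  then show ?thesis
    using openin_continuous_map_preimage[OF continuous_group_part U'(1)] openin_Hclass by auto
qed

text \<open>The neighbourhood condition at the points other than \<open>None\<close> says that \<open>W\<close> is open for the
  topological sum of the copies of \<open>G\<close>; since the classes are open in \<open>X\<close>, this is the topology that \<open>X\<close>
  induces away from the zero.\<close>

lemma reilly_base_cond_iff:
  assumes W: "W \<subseteq> reilly0_carrier (carrier G)"
  shows "reilly_base_cond (subtopology X (carrier G)) W \<longleftrightarrow> openin X (coord0 ` W - {z})"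
proof
  assume B: "reilly_base_cond (subtopology X (carrier G)) W"
  show "openin X (coord0 ` W - {z})"
    unfolding openin_subopen[of X "coord0 ` W - {z}"]
  proof
    fix x assume "x \<in> coord0 ` W - {z}"
    then obtain p where p: "p \<in> W" "x = coord0 p" "p \<noteq> None"
      by (metis DiffE coord0.simps(1) imageE singletonI)
    then obtain i s j where q: "p = Some (i, s, j)" by (metis not_None_eq prod_cases3)
    then obtain U where U: "openin (subtopology X (carrier G)) U" "s \<in> U" "reilly_box i U j \<subseteq> W"
      using B p(1) unfolding reilly_base_cond_def by blast
    have "U \<subseteq> carrier G" using openin_subset[OF U(1)] by auto
    have "coord (i, t, j) \<in> coord0 ` W - {z}" if t: "t \<in> U" for t
    proof -
      have "Some (i, t, j) \<in> W" using U(3) t by (auto simp: reilly_box_def)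
      then have "coord0 (Some (i, t, j)) \<in> coord0 ` W" by (rule imageI)
      moreover have "coord (i, t, j) \<noteq> z" using t \<open>U \<subseteq> carrier G\<close> coord_nonzero by blast
      ultimately show ?thesis by simp
    qed
    then have "(\<lambda>s. coord (i, s, j)) ` U \<subseteq> coord0 ` W - {z}" by blast
    then show "\<exists>T. openin X T \<and> x \<in> T \<and> T \<subseteq> coord0 ` W - {z}"
      using openin_coord_image[OF U(1), of i j] U(2) p(2) q by auto
  qed
next
  assume O: "openin X (coord0 ` W - {z})"
  show "reilly_base_cond (subtopology X (carrier G)) W"
    unfolding reilly_base_cond_def
  proof (intro conjI allI impI)
    have "carrier G \<subseteq> topspace X" using compact_G by (rule compactin_subset_topspace)
    then show "W \<subseteq> reilly0_carrier (topspace (subtopology X (carrier G)))"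
      using W by (simp add: Int_absorb1)
    fix i s j assume s: "Some (i, s, j) \<in> W"
    then have sG: "s \<in> carrier G" using W by (auto simp: reilly0_carrier_def)
    define U where "U = {t \<in> topspace X. coord (i, t, j) \<in> coord0 ` W - {z}} \<inter> carrier G"
    have "openin (subtopology X (carrier G)) U"
      unfolding U_def openin_subtopology using openin_continuous_map_preimage[OF continuous_coord O] by blast
    moreover have "s \<in> U"
      using imageI[OF s, of coord0] coord_nonzero[OF sG, of i j] sG by (simp add: U_def)
    moreover have "reilly_box i U j \<subseteq> W"
    proof
      fix p assume "p \<in> reilly_box i U j"
      then obtain t where t: "t \<in> U" "p = Some (i, t, j)" by (auto simp: reilly_box_def)
      then have "coord0 p \<in> coord0 ` W" "p \<in> reilly0_carrier (carrier G)"
        by (simp_all add: U_def reilly0_carrier_def)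
      then show "p \<in> W" using coord0_in_image_iff[OF W] by blast
    qed
    ultimately show "\<exists>U. openin (subtopology X (carrier G)) U \<and> s \<in> U \<and> reilly_box i U j \<subseteq> W"
      by blast
  qed
qed

text \<open>Reduces both alternatives to comparing the open sets along the bijection \<open>coord0\<close>.\<close>

lemma topologically_isomorphicI:
  assumes top: "topspace Y = reilly0_carrier (carrier G)"
    and iff: "\<And>W. W \<subseteq> reilly0_carrier (carrier G) \<Longrightarrow> openin Y W \<longleftrightarrow> openin X (coord0 ` W)"
  shows "topologically_isomorphic X f Y (reilly0_mult G endo)"
proof -
  interpret group G by (rule G_group)
  have bij: "coord0 ` topspace Y = topspace X" "inj_on coord0 (topspace Y)"
    using bij_betw_coord0 by (simp_all add: top bij_betw_def)
  have "homeomorphic_map Y X coord0"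
  proof (rule bijective_open_imp_homeomorphic_map)
    show "continuous_map Y X coord0"
      unfolding continuous_map
    proof (intro conjI allI impI)
      fix V assume V: "openin X V"
      have "V \<subseteq> coord0 ` topspace Y" using bij(1) openin_subset[OF V] by simp
      then have "coord0 ` {p \<in> topspace Y. coord0 p \<in> V} = V" by blast
      then show "openin Y {p \<in> topspace Y. coord0 p \<in> V}"
        using iff[of "{p \<in> topspace Y. coord0 p \<in> V}"] V top by auto
    qed (use bij in auto)
    show "open_map Y X coord0"
      unfolding open_map_def using iff openin_subset top by metis
  qed (use bij in auto)
  then obtain h where h: "homeomorphic_maps Y X coord0 h" by (auto simp: homeomorphic_map_maps)
  then have hom: "homeomorphic_map X Y h"
    using homeomorphic_maps_map homeomorphic_maps_sym by blast
  have hX: "h x \<in> topspace Y" "coord0 (h x) = x" if "x \<in> topspace X" for x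
    using h that by (auto simp: homeomorphic_maps_def continuous_map_def)
  have hY: "h (coord0 p) = p" if "p \<in> topspace Y" for p
    using h that by (auto simp: homeomorphic_maps_def)
  have cl: "reilly0_mult G endo p q \<in> topspace Y" if "p \<in> topspace Y" "q \<in> topspace Y" for p q
    using that by (auto simp: top reilly0_carrier_def endo_funpow_carrier)
  have "h (x \<cdot> y) = reilly0_mult G endo (h x) (h y)" if "x \<in> topspace X" "y \<in> topspace X" for x y
    using coord0_mult[of "h x" "h y"] hX[OF that(1)] hX[OF that(2)] hY[OF cl] top by metis
  then show ?thesis using hom by (auto simp: topologically_isomorphic_def)
qed

lemma isomorphic_sum_topology:
  assumes z: "openin X {z}"
  shows "topologically_isomorphic X f
    (reilly0_sum_topology (subtopology X (carrier G))) (reilly0_mult G endo)"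
proof (rule topologically_isomorphicI)
  have "carrier G \<subseteq> topspace X" using compact_G by (rule compactin_subset_topspace)
  then show "topspace (reilly0_sum_topology (subtopology X (carrier G))) = reilly0_carrier (carrier G)"
    by (simp add: topspace_reilly0_sum_topology Int_absorb1)
  fix W assume W: "W \<subseteq> reilly0_carrier (carrier G)"
  have "openin X (coord0 ` W)" if O: "openin X (coord0 ` W - {z})"
  proof (cases "z \<in> coord0 ` W")
    case True
    then have "coord0 ` W = (coord0 ` W - {z}) \<union> {z}" by blast
    then show ?thesis using openin_Un[OF O z] by metis
  next
    case False
    then show ?thesis using O by simp
  qed
  then have "openin X (coord0 ` W) \<longleftrightarrow> openin X (coord0 ` W - {z})"
    using closedin_zero by (auto intro: openin_diff)
  then show "openin (reilly0_sum_topology (subtopology X (carrier G))) W \<longleftrightarrow> openin X (coord0 ` W)"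
    using reilly_base_cond_iff[OF W] by (simp add: openin_reilly0_sum_topology)
qed

text \<open>The points of \<open>K\<close> that \<open>T\<close> moves out of \<open>V\<close> form a compact set not containing the zero, and
  finitely many of the disjoint open classes cover it.\<close>

lemma finite_Hclasses_escaping:
  assumes K: "compactin X K" and T: "continuous_map X X T" "T z = z"
    and V: "openin X V" "z \<in> V"
  shows "finite {(i, j). \<exists>x\<in>K \<inter> Hclass i j. T x \<notin> V}"
proof -
  define C where "C = K - {x \<in> topspace X. T x \<in> V}"
  have "closedin X (topspace X - {x \<in> topspace X. T x \<in> V})"
    using openin_continuous_map_preimage[OF T(1) V(1)] by blast
  moreover have "C = (topspace X - {x \<in> topspace X. T x \<in> V}) \<inter> K"
    using compactin_subset_topspace[OF K] by (auto simp: C_def)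
  ultimately have "compactin X C" using closed_Int_compactin[OF _ K] by simp
  moreover have "C \<subseteq> \<Union> ((\<lambda>(i, j). Hclass i j) ` UNIV)"
  proof
    fix x assume "x \<in> C"
    then have "x \<in> topspace X" "x \<noteq> z"
      using compactin_subset_topspace[OF K] T(2) V by (auto simp: C_def)
    then show "x \<in> \<Union> ((\<lambda>(i, j). Hclass i j) ` UNIV)" using ex_Hclass by fastforce
  qed
  ultimately obtain \<F> where "finite \<F>" "\<F> \<subseteq> (\<lambda>(i, j). Hclass i j) ` UNIV" and C: "C \<subseteq> \<Union>\<F>"
    using compactinD[of X C "(\<lambda>(i, j). Hclass i j) ` UNIV"] openin_Hclass by (auto simp: image_def)
  then obtain F where F: "finite F" "\<F> = (\<lambda>(i, j). Hclass i j) ` F"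
    using finite_subset_image by metis
  have "{(i, j). \<exists>x\<in>K \<inter> Hclass i j. T x \<notin> V} \<subseteq> F"
  proof clarify
    fix i j x assume x: "x \<in> K" "x \<in> Hclass i j" "T x \<notin> V"
    then obtain m n where "(m, n) \<in> F" "x \<in> Hclass m n" using C F(2) by (auto simp: C_def)
    then show "(i, j) \<in> F" using Hclass_disjoint[OF x(2)] by auto
  qed
  then show ?thesis using F(1) finite_subset by blast
qed

text \<open>The set \<open>A i j\<close> of group coordinates of \<open>V \<inter> Hclass i j\<close> is constant outside a finite square, since
  the translations by \<open>a\<close> and \<open>b\<close> connect neighbouring classes. The constant value is nonempty because the
  zero is not isolated, and invariant under left multiplication by \<open>G\<close>; so it is \<open>G\<close>.\<close>

lemma almost_all_Hclasses_in_compact_neighbourhood: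
  assumes nz: "\<not> openin X {z}"
    and V: "openin X V" "z \<in> V" and K: "compactin X K" "V \<subseteq> K"
  shows "\<exists>N. \<forall>i j s. N \<le> i \<or> N \<le> j \<longrightarrow> s \<in> carrier G \<longrightarrow> coord (i, s, j) \<in> V"
proof -
  interpret group G by (rule G_group)
  define A where "A i j = {s \<in> carrier G. coord (i, s, j) \<in> V}" for i j
  define bad where "bad T = {(i, j). \<exists>x\<in>K \<inter> Hclass i j. T x \<notin> V}" for T
  have fin: "finite (bad (\<lambda>y. x \<cdot> y))" "finite (bad (\<lambda>y. y \<cdot> x))" if "x \<in> topspace X" for x
    unfolding bad_def using that
    by (auto intro!: finite_Hclasses_escaping K V continuous_left continuous_right)
  have good: "T (coord (i, s, j)) \<in> V" if "(i, j) \<notin> bad T" "s \<in> A i j" for i j s T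
    using that K(2) coord_Hclass[of s i j] by (auto simp: bad_def A_def)
  define B where "B = bad (\<lambda>y. a \<cdot> y) \<union> bad (\<lambda>y. b \<cdot> y) \<union> bad (\<lambda>y. y \<cdot> a) \<union> bad (\<lambda>y. y \<cdot> b)"
  have "finite (fst ` B \<union> snd ` B)" unfolding B_def using fin by simp
  then obtain N where N: "\<And>n. n \<in> fst ` B \<union> snd ` B \<Longrightarrow> n < N"
    unfolding finite_nat_set_iff_bounded by metis
  have notB: "(i, j) \<notin> B" if "N \<le> i \<or> N \<le> j" for i j
    using that N[of i] N[of j] by (force simp: image_iff)
  \<comment> \<open>The two inclusions come from translations by \<open>a\<close> and by \<open>b\<close>; both \<open>(i, j)\<close> and its successor
    lie outside the square.\<close>
  have step1: "A (Suc i) j = A i j" if "N \<le> i \<or> N \<le> j" for i j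
    using good[of "Suc i" j "\<lambda>y. a \<cdot> y"] good[of i j "\<lambda>y. b \<cdot> y"] notB[of i j] notB[of "Suc i" j] that
    by (auto simp: B_def A_def coord_shift)
  have step2: "A i (Suc j) = A i j" if "N \<le> i \<or> N \<le> j" for i j
    using good[of i "Suc j" "\<lambda>y. y \<cdot> b"] good[of i j "\<lambda>y. y \<cdot> a"] notB[of i j] notB[of i "Suc j"] that
    by (auto simp: B_def A_def coord_shift)
  have row: "A i j = A 0 j" if "N \<le> j" for i j
    using that by (induction i) (auto simp: step1)
  have col: "A i j = A i 0" if "N \<le> i" for i j
    using that by (induction j) (auto simp: step2)
  have base: "A 0 (N + d) = A 0 N" for d
    by (induction d) (auto simp: step2)
  \<comment> \<open>The index pairs outside the square are connected by unit steps, through column \<open>N\<close> or row \<open>0\<close>.\<close>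
  have const: "A i j = A 0 N" if "N \<le> i \<or> N \<le> j" for i j
    using that
  proof
    assume "N \<le> i"
    then have "A i j = A i N" using col[of i j] col[of i N] by simp
    then show ?thesis using row[of N i] by simp
  next
    assume "N \<le> j"
    then show ?thesis using row[of j i] base[of "j - N"] by simp
  qed
  \<comment> \<open>Removing the finitely many closed classes in the square leaves a neighbourhood of the zero.\<close>
  obtain s where s: "s \<in> A 0 N"
  proof -
    have "closedin X (\<Union>(i, j)\<in>{..<N} \<times> {..<N}. Hclass i j)"
      by (rule closedin_Union) (auto simp: closedin_Hclass)
    then have O: "openin X (V - (\<Union>(i, j)\<in>{..<N} \<times> {..<N}. Hclass i j))"
      using V(1) by (rule openin_diff[rotated])
    then obtain x where x: "x \<in> V" "x \<notin> (\<Union>(i, j)\<in>{..<N} \<times> {..<N}. Hclass i j)" "x \<noteq> z"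
    proof -
      have "z \<in> V - (\<Union>(i, j)\<in>{..<N} \<times> {..<N}. Hclass i j)" using V(2) by auto
      moreover have "V - (\<Union>(i, j)\<in>{..<N} \<times> {..<N}. Hclass i j) \<noteq> {z}" using O nz by metis
      ultimately show ?thesis using that by blast
    qed
    then have "x \<in> topspace X" using openin_subset[OF V(1)] by blast
    then obtain i j where ij: "x \<in> Hclass i j" using ex_Hclass x(3) by blast
    then have "N \<le> i \<or> N \<le> j" using x(2) by force
    moreover have "group_part i j x \<in> A i j"
      using ij x(1) by (simp add: A_def coord_group_part group_part_carrier)
    ultimately show thesis using that const by blast
  qed
  then have sG: "s \<in> carrier G" by (simp add: A_def)
  \<comment> \<open>The exceptional classes depend on \<open>g\<close>, but each \<open>g\<close> has some \<open>j \<ge> N\<close> that is not exceptional.\<close>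
  have "t \<in> A 0 N" if t: "t \<in> carrier G" for t
  proof -
    define g where "g = t \<otimes>\<^bsub>G\<^esub> inv\<^bsub>G\<^esub> s"
    have g: "g \<in> carrier G" "g \<otimes>\<^bsub>G\<^esub> s = t" using t sG by (simp_all add: g_def m_assoc)
    have "finite (snd ` bad (\<lambda>y. lift g \<cdot> y))" using fin(1)[of "lift g"] g by simp
    then obtain M where M: "\<And>n. n \<in> snd ` bad (\<lambda>y. lift g \<cdot> y) \<Longrightarrow> n < M"
      unfolding finite_nat_set_iff_bounded by metis
    define j where "j = max M N"
    have "(0, j) \<notin> bad (\<lambda>y. lift g \<cdot> y)" using M[of j] by (force simp: j_def image_iff)
    moreover have Aj: "A 0 j = A 0 N" using const[of 0 j] by (simp add: j_def)
    ultimately have "lift g \<cdot> coord (0, s, j) \<in> V" using good s by blast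
    then show ?thesis using g t sG Aj by (auto simp: lift_coord A_def)
  qed
  then have "A i j = carrier G" if "N \<le> i \<or> N \<le> j" for i j
    using const[OF that] by (auto simp: A_def)
  then show ?thesis by (auto simp: A_def)
qed

text \<open>Local compactness shrinks an arbitrary neighbourhood into a compact one.\<close>

lemma almost_all_Hclasses_in_neighbourhood:
  assumes lc: "locally_compact_space X" and nz: "\<not> openin X {z}"
    and V: "openin X V" "z \<in> V"
  shows "\<exists>F. finite F \<and> (\<forall>i j s. (i, j) \<notin> F \<longrightarrow> s \<in> carrier G \<longrightarrow> coord (i, s, j) \<in> V)"
proof -
  obtain U K where UK: "openin X U" "compactin X K" "z \<in> U" "U \<subseteq> K"
    using lc z_closed unfolding locally_compact_space_def by blast
  have "openin X (U \<inter> V)" "z \<in> U \<inter> V" "U \<inter> V \<subseteq> K" using UK V by auto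
  from almost_all_Hclasses_in_compact_neighbourhood[OF nz this(1,2) UK(2) this(3)]
  obtain N where N: "\<And>i j s. N \<le> i \<or> N \<le> j \<Longrightarrow> s \<in> carrier G \<Longrightarrow> coord (i, s, j) \<in> U \<inter> V"
    by metis
  show ?thesis
    by (rule exI[of _ "{..<N} \<times> {..<N}"]) (use N in \<open>force simp: not_less\<close>)
qed

lemma isomorphic_Ac_topology:
  assumes lc: "locally_compact_space X" and nz: "\<not> openin X {z}"
  shows "topologically_isomorphic X f
    (reilly0_Ac_topology (subtopology X (carrier G))) (reilly0_mult G endo)"
proof (rule topologically_isomorphicI)
  have sub: "carrier G \<subseteq> topspace X" using compact_G by (rule compactin_subset_topspace)
  then show "topspace (reilly0_Ac_topology (subtopology X (carrier G))) = reilly0_carrier (carrier G)"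
    by (simp add: topspace_reilly0_Ac_topology Int_absorb1)
  fix W assume W: "W \<subseteq> reilly0_carrier (carrier G)"
  let ?C = "\<lambda>F. reilly0_carrier (carrier G) - (\<Union>(i, j)\<in>F. reilly_box i (carrier G) j)"
  have zW: "z \<in> coord0 ` W \<longleftrightarrow> None \<in> W"
    using coord0_in_image_iff[OF W, of None] by (simp add: reilly0_carrier_def)
  have "openin X (coord0 ` W) \<longleftrightarrow> openin X (coord0 ` W - {z}) \<and> (None \<in> W \<longrightarrow> (\<exists>F. finite F \<and> ?C F \<subseteq> W))"
  proof (intro iffI conjI impI)
    assume O: "openin X (coord0 ` W)"
    then show "openin X (coord0 ` W - {z})" using closedin_zero by (rule openin_diff)
    assume "None \<in> W"
    then obtain F where F: "finite F"
      "\<And>i j s. (i, j) \<notin> F \<Longrightarrow> s \<in> carrier G \<Longrightarrow> coord (i, s, j) \<in> coord0 ` W"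
      using almost_all_Hclasses_in_neighbourhood[OF lc nz O] zW by blast
    have "?C F \<subseteq> W"
    proof
      fix p assume p: "p \<in> ?C F"
      show "p \<in> W"
      proof (cases p)
        case None
        then show ?thesis using \<open>None \<in> W\<close> by simp
      next
        case (Some q)
        then obtain i s j where q: "p = Some (i, s, j)" by (metis prod_cases3)
        then have "s \<in> carrier G" "(i, j) \<notin> F" using p by (auto simp: reilly0_carrier_def reilly_box_def)
        then have "coord0 p \<in> coord0 ` W" using F(2) q by simp
        then show ?thesis using coord0_in_image_iff[OF W] p by blast
      qed
    qed
    then show "\<exists>F. finite F \<and> ?C F \<subseteq> W" using F(1) by blast
  next
    assume asm: "openin X (coord0 ` W - {z}) \<and> (None \<in> W \<longrightarrow> (\<exists>F. finite F \<and> ?C F \<subseteq> W))"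
    show "openin X (coord0 ` W)"
    proof (cases "None \<in> W")
      case True
      then obtain F where F: "finite F" "?C F \<subseteq> W" using asm by blast
      define D where "D = topspace X - (\<Union>(i, j)\<in>F. Hclass i j)"
      have "closedin X (\<Union>(i, j)\<in>F. Hclass i j)"
        by (rule closedin_Union) (use F(1) in \<open>auto simp: closedin_Hclass\<close>)
      then have D: "openin X D" by (simp add: D_def openin_diff)
      have "D \<subseteq> coord0 ` W"
      proof
        fix x assume x: "x \<in> D"
        then obtain p where p: "p \<in> reilly0_carrier (carrier G)" "x = coord0 p"
          using bij_betw_imp_surj_on[OF bij_betw_coord0] by (force simp: D_def)
        have "p \<notin> (\<Union>(i, j)\<in>F. reilly_box i (carrier G) j)"
          using x p(2) coord_Hclass by (force simp: reilly_box_def D_def)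
        then show "x \<in> coord0 ` W" using F(2) p by blast
      qed
      moreover have "z \<in> D" by (auto simp: D_def)
      ultimately have "coord0 ` W = (coord0 ` W - {z}) \<union> D" by blast
      then show ?thesis using asm D openin_Un by metis
    next
      case False
      then show ?thesis using asm zW by simp
    qed
  qed
  then show "openin (reilly0_Ac_topology (subtopology X (carrier G))) W \<longleftrightarrow> openin X (coord0 ` W)"
    using reilly_base_cond_iff[OF W] sub by (simp add: openin_reilly0_Ac_topology Int_absorb1)
qed

end

section \<open>The classification\<close>

theorem theorem3p13:
  fixes X :: "'a topology" and f :: "'a \<Rightarrow> 'a \<Rightarrow> 'a" and z :: 'a and G :: "'a monoid"
  assumes "zero_bisimple_omega_semigroup (topspace X) f z"
    and "semitopological_semigroup X f"
    and "Hausdorff_space X"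
    and "locally_compact_space X"
    and "maximal_subgroup_of_semigroup (topspace X) f G"
    and "compactin X (carrier G)"
    and "carrier G \<noteq> {z}"
  shows "\<exists>\<theta>. \<theta> \<in> hom G G \<and>
      continuous_map (subtopology X (carrier G)) (subtopology X (carrier G)) \<theta> \<and>
      (topologically_isomorphic X f
         (reilly0_sum_topology (subtopology X (carrier G))) (reilly0_mult G \<theta>) \<or>
       topologically_isomorphic X f
         (reilly0_Ac_topology (subtopology X (carrier G))) (reilly0_mult G \<theta>))"
proof -
  obtain E a where E: "zero_bisimple_omega (topspace X) f z E" and a: "a \<in> topspace X"
    "f a (inverse_semigroup.sinv (topspace X) f a) = E 0"
    "f (inverse_semigroup.sinv (topspace X) f a) a = E 1"
    using zero_bisimple_omega_semigroupE[OF assms(1)] by metis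
  interpret zero_bisimple_omega "topspace X" f z E by (rule E)
  interpret reilly_coordinates "topspace X" f z E a "sinv a"
    by unfold_locales (use a in auto)
  have G: "group G" "carrier G \<subseteq> topspace X"
    "\<And>x y. x \<in> carrier G \<Longrightarrow> y \<in> carrier G \<Longrightarrow> x \<otimes>\<^bsub>G\<^esub> y = f x y"
    using assms(5) by (auto simp: maximal_subgroup_of_semigroup_def subgroup_of_semigroup_def)
  interpret group G by (rule G(1))
  note max = maximal_subgroup_carrier[OF assms(5)]
  have "\<one>\<^bsub>G\<^esub> \<noteq> z"
  proof
    assume eq: "\<one>\<^bsub>G\<^esub> = z"
    have "x = z" if "x \<in> carrier G" for x
      using that eq G(2) G(3)[OF one_closed that] l_one[OF that] zero_mult(1)[of x] by auto
    then show False using assms(7) eq one_closed by blast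
  qed
  then obtain k where k: "\<one>\<^bsub>G\<^esub> = E k" using ex_E max(1) by blast
  interpret topological_reilly_group X f z E a "sinv a" G k
  proof unfold_locales
    show "carrier G = Hclass k k" using max(2) by (simp add: Hclass_def k)
  qed (use G assms(2,3,6) in \<open>auto simp: semitopological_semigroup_def\<close>)
  show ?thesis
    using endo_hom continuous_endo isomorphic_sum_topology isomorphic_Ac_topology[OF assms(4)]
    by blast
qed

end
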